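(* Let $E$ be a sandpile graph and let $S_E$ be the set of all vertices in $E$ which do not connect to any cycle in $E$. Then the following statements hold: (1) $\mathrm{SP}(E_H)$ is a submonoid of $\mathrm{SP}(E_{H'})$ for all $H, H'\in\mathcal{H}_E$ with $H\subseteq H'$; (2) $\mathrm{SP}(E_{S_E}) = Z(\mathrm{SP}(E))$, where $Z(\mathrm{SP}(E))$ is the unit group of $\mathrm{SP}(E)$; (3) for all $H\in\mathcal{H}_E$, $\mathrm{SP}(E_H)$ is an order-ideal of $\mathrm{SP}(E)$ containing $Z(\mathrm{SP}(E))$, and $\mathrm{SP}(E_H)=\langle H\rangle$ (the order-ideal of $\mathrm{SP}(E)$ generated by $H$); (4) for every order-ideal $I$ of $\mathrm{SP}(E)$, $I=\mathrm{SP}(E_H)$, where $H=I\cap E^0\in\mathcal{H}_E$; (5) $\mathcal{H}_E\cong\mathcal{L}(\mathrm{SP}(E))$ as lattices; (6) $G(E)=\varinjlim_{H\in\mathcal{H}_E}G(E_H)$, where $G(E_H):=G(\mathrm{SP}(E_H))$; (7) for all $H\in\mathcal{H}_E$, $G(E_H)=z_H+\mathrm{SP}(E_H)$, where $z_H:=\sum_{x\in\mathrm{Idem}(\mathrm{SP}(E_H))}x$. Consequently, $G(E_H)$ is a maximal subgroup of $\mathrm{SP}(E)$.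
   Context: Graphs are directed: $E=(E^0,E^1,s,r)$ with vertex set $E^0$, edge set $E^1$, source and range maps $s,r:E^1\to E^0$. A sink is a vertex emitting no edges; a vertex is regular if it is not a sink and emits only finitely many edges; $E^0_{\mathrm{reg}}$ is the set of regular vertices. Vertices are paths of length $0$. A closed path based at $v$ is a path $p$ with $s(p)=r(p)=v$; a cycle is a closed path $e_1\cdots e_n$ ($n\ge 1$) with $s(e_i)\ne s(e_j)$ for $i\neq j$. A vertex connects to a cycle if there is a path from it to a vertex of the cycle. A sandpile graph is a finite directed graph with a unique sink (also denoted $s$) such that from every vertex there is a path to $s$. Its sandpile monoid is the commutative monoid $$\mathrm{SP}(E)=\langle v\mid v\in E^0\rangle\big/\big\langle s=0;\ |s^{-1}(v)|\,v=\textstyle\sum_{e\in s^{-1}(v)}r(e)\ \text{for all } v\in E^0\setminus\{s\}\big\rangle,$$ the quotient of the free commutative monoid on $E^0$ by the congruence generated by these relations. The same symbol denotes an element of the free commutative monoid and its class in $\mathrm{SP}(E)$; $I\cap E^0$ is the set of vertices whose class lies in $I$. $H\subseteq E^0$ is hereditary if $s(e)\in H$ implies $r(e)\in H$ for all $e\in E^1$; it is saturated if $v\in E^0_{\mathrm{reg}}$ and $r(s^{-1}(v))\subseteq H$ imply $v\in H$. The hereditary saturated closure $\overline{H}$ is the smallest hereditary saturated set containing $H$. $\mathcal{H}_E$ is the set of all nonempty saturated hereditary subsets of $E^0$, a lattice under inclusion with $H\vee H'=\overline{H\cup H'}$, $H\wedge H'=H\cap H'$; its smallest element is $S_E$. For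 $H\in\mathcal{H}_E$, the restriction graph $E_H$ has $E_H^0=H$, $E_H^1=\{e\in E^1\mid s(e)\in H\}$, with restricted source and range maps; it is a sandpile graph. $\mathrm{SP}(E_H)$ is viewed inside $\mathrm{SP}(E_{H'})$ (for $H\subseteq H'$ in $\mathcal{H}_E$) and inside $\mathrm{SP}(E)$ via the natural map $x\mapsto x$. For a commutative monoid $M$, the canonical preorder is $x\le y$ iff $y=x+m$ for some $m\in M$. An order-ideal of $M$ is a submonoid $I$ such that $x+y\in I$ implies $x,y\in I$. The order-ideal generated by $X\subseteq M$ is $\langle X\rangle=\{m\in M\mid m\le\sum_{i=1}^n x_i,\ n\ge 1,\ x_i\in X\}$. $\mathcal{L}(M)$ is the lattice (under inclusion) of all order-ideals of $M$. $\mathrm{Idem}(M)$ is the set of idempotents ($m+m=m$). A maximal subgroup of $M$ is the unit group of the monoid $x+M$ (with identity $x$) for some $x\in\mathrm{Idem}(M)$. The Grothendieck group $G(M)$ of a commutative semigroup $M$ is the set of classes $[(m_1,m_2)]_0$ of $M\times M$ under $(m_1,m_2)\sim(n_1,n_2)$ iff $m_1+n_2+x=m_2+n_1+x$ for some $x\in M$, with componentwise addition. The sandpile group of $E$ is $G(E):=G(\mathrm{SP}(E))$. For finite $M$, $G(M)$ is isomorphic to the smallest ideal $\bigcap_{x\in M}(x+M)$ of $M$, and the sandpile group of a sandpile graph $F$ is identified with the smallest ideal of $\mathrm{SP}(F)$, i.e. with the set of recurrent elements (elements $a$ such that for every $c\in \mathrm{SP}(F)$ there is $x\in \mathrm{SP}(F)$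 with $a=c+x$). The direct limit in (6) is taken along the group homomorphisms $G(E_H)\to G(E_{H'})$, $[(a,b)]_0\mapsto[(a,b)]_0$, for $H\subseteq H'$. *)

theory Defs
  imports
    "Graph_Theory.Digraph"
    "Graph_Theory.Arc_Walk"
    "HOL-Algebra.Group"
    "HOL-Algebra.Coset"
    "HOL-Algebra.FiniteProduct"
    "HOL-Algebra.Divisibility"
    "HOL-Algebra.Lattice"
begin

section \<open>Commutative monoids\<close>

text \<open>
  Commutative monoids are \<open>HOL-Algebra\<close> monoid records, hence written multiplicatively: the
  sum \<open>x + y\<close> is \<^term>\<open>x \<otimes>\<^bsub>M\<^esub> y\<close>, the element \<open>0\<close> is \<^term>\<open>\<one>\<^bsub>M\<^esub>\<close>, the coset \<open>x + A\<close> is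
  \<^term>\<open>x <#\<^bsub>M\<^esub> A\<close>, and the canonical preorder \<open>x \<le> y\<close> is \<^term>\<open>x divides\<^bsub>M\<^esub> y\<close>.
\<close>

definition idempotents :: "('a, 'm) monoid_scheme \<Rightarrow> 'a set" where
  "idempotents M = {x \<in> carrier M. x \<otimes>\<^bsub>M\<^esub> x = x}"

text \<open>The monoid \<open>x + M\<close> with identity \<open>x\<close>, for an idempotent \<open>x\<close>.\<close>

definition idem_monoid :: "('a, 'm) monoid_scheme \<Rightarrow> 'a \<Rightarrow> ('a, 'm) monoid_scheme" where
  "idem_monoid M x = M\<lparr>carrier := x <#\<^bsub>M\<^esub> carrier M, monoid.one := x\<rparr>"

definition maximal_subgroup :: "'a set \<Rightarrow> ('a, 'm) monoid_scheme \<Rightarrow> bool" where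
  "maximal_subgroup S M \<longleftrightarrow> (\<exists>x \<in> idempotents M. S = Units (idem_monoid M x))"

definition order_ideal :: "'a set \<Rightarrow> ('a, 'm) monoid_scheme \<Rightarrow> bool" where
  "order_ideal I M \<longleftrightarrow> submonoid I M \<and>
     (\<forall>x \<in> carrier M. \<forall>y \<in> carrier M. x \<otimes>\<^bsub>M\<^esub> y \<in> I \<longrightarrow> x \<in> I \<and> y \<in> I)"

definition order_ideal_gen :: "('a, 'm) monoid_scheme \<Rightarrow> 'a set \<Rightarrow> 'a set" where
  "order_ideal_gen M X = {m \<in> carrier M.
     \<exists>n::nat. n \<ge> 1 \<and> (\<exists>x \<in> {1..n} \<rightarrow> X. m divides\<^bsub>M\<^esub> (\<Otimes>\<^bsub>M\<^esub>i \<in> {1..n}. x i))}"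

definition recurrent :: "('a, 'm) monoid_scheme \<Rightarrow> 'a set" where
  "recurrent M = {a \<in> carrier M. \<forall>c \<in> carrier M. \<exists>x \<in> carrier M. a = c \<otimes>\<^bsub>M\<^esub> x}"

subsection \<open>Grothendieck group\<close>

definition groth_rel :: "('a, 'm) monoid_scheme \<Rightarrow> (('a \<times> 'a) \<times> ('a \<times> 'a)) set" where
  "groth_rel M = {((m1, m2), (n1, n2)).
     m1 \<in> carrier M \<and> m2 \<in> carrier M \<and> n1 \<in> carrier M \<and> n2 \<in> carrier M \<and>
     (\<exists>x \<in> carrier M. m1 \<otimes>\<^bsub>M\<^esub> n2 \<otimes>\<^bsub>M\<^esub> x = m2 \<otimes>\<^bsub>M\<^esub> n1 \<otimes>\<^bsub>M\<^esub> x)}"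

definition groth_class :: "('a, 'm) monoid_scheme \<Rightarrow> 'a \<Rightarrow> 'a \<Rightarrow> ('a \<times> 'a) set" where
  "groth_class M a b = groth_rel M `` {(a, b)}"

text \<open>The identity is the common class of all pairs \<open>(m, m)\<close>.\<close>

definition grothendieck :: "('a, 'm) monoid_scheme \<Rightarrow> ('a \<times> 'a) set monoid" where
  "grothendieck M = \<lparr>
     carrier = (carrier M \<times> carrier M) // groth_rel M,
     monoid.mult = (\<lambda>A B. groth_rel M ``
        {(a1 \<otimes>\<^bsub>M\<^esub> b1, a2 \<otimes>\<^bsub>M\<^esub> b2) | a1 a2 b1 b2. (a1, a2) \<in> A \<and> (b1, b2) \<in> B}),
     monoid.one = groth_rel M `` {(m, m) | m. m \<in> carrier M}\<rparr>"

text \<open>The map \<open>[(a, b)] \<mapsto> [(f a, f b)]\<close> into the Grothendieck group of \<open>N\<close> induced by a monoid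
  homomorphism \<open>f\<close> into \<open>N\<close>.\<close>

definition groth_map ::
    "('b, 'n) monoid_scheme \<Rightarrow> ('a \<Rightarrow> 'b) \<Rightarrow> ('a \<times> 'a) set \<Rightarrow> ('b \<times> 'b) set" where
  "groth_map N f X = groth_rel N `` {(f a, f b) | a b. (a, b) \<in> X}"

subsection \<open>Monoids given by generators and relations\<close>

text \<open>The free commutative monoid on \<open>V\<close> consists of the finite multisets of elements of \<open>V\<close>;
  \<open>gen_cong V R\<close> is the congruence on it generated by the pairs in \<open>R\<close>.\<close>

inductive_set gen_cong ::
    "'v set \<Rightarrow> ('v multiset \<times> 'v multiset) set \<Rightarrow> ('v multiset \<times> 'v multiset) set"
  for V :: "'v set" and R :: "('v multiset \<times> 'v multiset) set"
where
  base: "(a, b) \<in> R \<Longrightarrow> set_mset a \<subseteq> V \<Longrightarrow> set_mset b \<subseteq> V \<Longrightarrow> (a, b) \<in> gen_cong V R"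
| refl: "set_mset a \<subseteq> V \<Longrightarrow> (a, a) \<in> gen_cong V R"
| sym: "(a, b) \<in> gen_cong V R \<Longrightarrow> (b, a) \<in> gen_cong V R"
| trans: "(a, b) \<in> gen_cong V R \<Longrightarrow> (b, c) \<in> gen_cong V R \<Longrightarrow> (a, c) \<in> gen_cong V R"
| add: "(a, b) \<in> gen_cong V R \<Longrightarrow> (c, d) \<in> gen_cong V R \<Longrightarrow> (a + c, b + d) \<in> gen_cong V R"

definition presented_monoid ::
    "'v set \<Rightarrow> ('v multiset \<times> 'v multiset) set \<Rightarrow> 'v multiset set monoid" where
  "presented_monoid V R = \<lparr>
     carrier = {a. set_mset a \<subseteq> V} // gen_cong V R,
     monoid.mult = (\<lambda>A B. gen_cong V R `` {a + b | a b. a \<in> A \<and> b \<in> B}),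
     monoid.one = gen_cong V R `` {{#}}\<rparr>"

section \<open>Sandpile graphs and their monoids\<close>

definition is_sink :: "('v, 'e) pre_digraph \<Rightarrow> 'v \<Rightarrow> bool" where
  "is_sink E v \<longleftrightarrow> v \<in> verts E \<and> out_arcs E v = {}"

locale sandpile_graph = fin_digraph E for E :: "('v, 'e) pre_digraph" (structure) +
  assumes unique_sink: "\<exists>!v. is_sink E v"
    and connects_to_sink: "v \<in> verts E \<Longrightarrow> is_sink E s \<Longrightarrow> v \<rightarrow>\<^sup>*\<^bsub>E\<^esub> s"

definition sandpile_relations :: "('v, 'e) pre_digraph \<Rightarrow> ('v multiset \<times> 'v multiset) set" where
  "sandpile_relations E =
     {({#v#}, {#}) | v. is_sink E v} \<union>
     {(replicate_mset (card (out_arcs E v)) v, image_mset (head E) (mset_set (out_arcs E v))) | v.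
        v \<in> verts E \<and> \<not> is_sink E v}"

definition SP :: "('v, 'e) pre_digraph \<Rightarrow> 'v multiset set monoid" where
  "SP E = presented_monoid (verts E) (sandpile_relations E)"

definition SP_class :: "('v, 'e) pre_digraph \<Rightarrow> 'v multiset \<Rightarrow> 'v multiset set" where
  "SP_class E a = gen_cong (verts E) (sandpile_relations E) `` {a}"

text \<open>The natural map \<open>x \<mapsto> x\<close> from \<open>SP(E\<^sub>H)\<close> to \<open>SP(F)\<close>, for \<open>F = E\<close> or \<open>F = E\<^sub>H\<^sub>'\<close>: the class of a
  multiset in \<open>SP(E\<^sub>H)\<close> goes to the class of the same multiset in \<open>SP(F)\<close>.\<close>

definition SP_map :: "('v, 'e) pre_digraph \<Rightarrow> 'v multiset set \<Rightarrow> 'v multiset set" where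
  "SP_map F X = gen_cong (verts F) (sandpile_relations F) `` X"

subsection \<open>Hereditary saturated sets\<close>

definition regular :: "('v, 'e) pre_digraph \<Rightarrow> 'v \<Rightarrow> bool" where
  "regular E v \<longleftrightarrow> v \<in> verts E \<and> \<not> is_sink E v \<and> finite (out_arcs E v)"

definition hereditary :: "('v, 'e) pre_digraph \<Rightarrow> 'v set \<Rightarrow> bool" where
  "hereditary E H \<longleftrightarrow> H \<subseteq> verts E \<and> (\<forall>e \<in> arcs E. tail E e \<in> H \<longrightarrow> head E e \<in> H)"

definition saturated :: "('v, 'e) pre_digraph \<Rightarrow> 'v set \<Rightarrow> bool" where
  "saturated E H \<longleftrightarrow> H \<subseteq> verts E \<and> (\<forall>v. regular E v \<and> head E ` out_arcs E v \<subseteq> H \<longrightarrow> v \<in> H)"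

definition hs_closure :: "('v, 'e) pre_digraph \<Rightarrow> 'v set \<Rightarrow> 'v set" where
  "hs_closure E H = (\<lambda>K. hereditary E K \<and> saturated E K) hull H"

definition hs_sets :: "('v, 'e) pre_digraph \<Rightarrow> 'v set set" where
  "hs_sets E = {H. H \<noteq> {} \<and> hereditary E H \<and> saturated E H}"

definition restriction :: "('v, 'e) pre_digraph \<Rightarrow> 'v set \<Rightarrow> ('v, 'e) pre_digraph" where
  "restriction E H = E\<lparr>verts := H, arcs := {e \<in> arcs E. tail E e \<in> H}\<rparr>"

text \<open>Loops count as cycles for \<open>pre_digraph.cycle\<close>, and the vertices of a cycle are the tails of
  its arcs.\<close>

definition connects_to_cycle :: "('v, 'e) pre_digraph \<Rightarrow> 'v \<Rightarrow> bool" where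
  "connects_to_cycle E v \<longleftrightarrow>
     (\<exists>p. pre_digraph.cycle E p \<and> (\<exists>e \<in> set p. v \<rightarrow>\<^sup>*\<^bsub>E\<^esub> tail E e))"

definition no_cycle_verts :: "('v, 'e) pre_digraph \<Rightarrow> 'v set" where
  "no_cycle_verts E = {v \<in> verts E. \<not> connects_to_cycle E v}"

section \<open>Lattices of sets\<close>

definition inclusion_order :: "'a set set \<Rightarrow> 'a set gorder" where
  "inclusion_order A = \<lparr>carrier = A, eq = (=), le = (\<subseteq>)\<rparr>"

definition lattice_iso ::
    "('a \<Rightarrow> 'b) \<Rightarrow> ('a, 'm) gorder_scheme \<Rightarrow> ('b, 'n) gorder_scheme \<Rightarrow> bool" where
  "lattice_iso f L K \<longleftrightarrow> bij_betw f (carrier L) (carrier K) \<and>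
     (\<forall>x \<in> carrier L. \<forall>y \<in> carrier L.
        f (x \<squnion>\<^bsub>L\<^esub> y) = f x \<squnion>\<^bsub>K\<^esub> f y \<and> f (x \<sqinter>\<^bsub>L\<^esub> y) = f x \<sqinter>\<^bsub>K\<^esub> f y)"

section \<open>Direct limits of groups\<close>

locale direct_system =
  fixes I :: "'i set" and rel :: "'i \<Rightarrow> 'i \<Rightarrow> bool"
    and G :: "'i \<Rightarrow> ('a, 'm) monoid_scheme" and \<phi> :: "'i \<Rightarrow> 'i \<Rightarrow> 'a \<Rightarrow> 'a"
  assumes nonempty: "I \<noteq> {}"
    and le_refl: "i \<in> I \<Longrightarrow> rel i i"
    and le_trans: "\<lbrakk>i \<in> I; j \<in> I; k \<in> I; rel i j; rel j k\<rbrakk> \<Longrightarrow> rel i k"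
    and directed: "\<lbrakk>i \<in> I; j \<in> I\<rbrakk> \<Longrightarrow> \<exists>k \<in> I. rel i k \<and> rel j k"
    and groups: "i \<in> I \<Longrightarrow> group (G i)"
    and homs: "\<lbrakk>i \<in> I; j \<in> I; rel i j\<rbrakk> \<Longrightarrow> \<phi> i j \<in> hom (G i) (G j)"
    and map_id: "\<lbrakk>i \<in> I; x \<in> carrier (G i)\<rbrakk> \<Longrightarrow> \<phi> i i x = x"
    and map_comp: "\<lbrakk>i \<in> I; j \<in> I; k \<in> I; rel i j; rel j k; x \<in> carrier (G i)\<rbrakk>
       \<Longrightarrow> \<phi> j k (\<phi> i j x) = \<phi> i k x"

text \<open>The direct limit is the disjoint union of the groups modulo eventual equality; two classes
  are multiplied by moving representatives to a common upper index.\<close>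

definition dirlim_rel :: "'i set \<Rightarrow> ('i \<Rightarrow> 'i \<Rightarrow> bool) \<Rightarrow> ('i \<Rightarrow> ('a, 'm) monoid_scheme)
    \<Rightarrow> ('i \<Rightarrow> 'i \<Rightarrow> 'a \<Rightarrow> 'a) \<Rightarrow> (('i \<times> 'a) \<times> ('i \<times> 'a)) set" where
  "dirlim_rel I rel G \<phi> = {((i, x), (j, y)).
     i \<in> I \<and> x \<in> carrier (G i) \<and> j \<in> I \<and> y \<in> carrier (G j) \<and>
     (\<exists>k \<in> I. rel i k \<and> rel j k \<and> \<phi> i k x = \<phi> j k y)}"

definition dirlim :: "'i set \<Rightarrow> ('i \<Rightarrow> 'i \<Rightarrow> bool) \<Rightarrow> ('i \<Rightarrow> ('a, 'm) monoid_scheme)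
    \<Rightarrow> ('i \<Rightarrow> 'i \<Rightarrow> 'a \<Rightarrow> 'a) \<Rightarrow> ('i \<times> 'a) set monoid" where
  "dirlim I rel G \<phi> = \<lparr>
     carrier = (SIGMA i:I. carrier (G i)) // dirlim_rel I rel G \<phi>,
     monoid.mult = (\<lambda>A B. dirlim_rel I rel G \<phi> ``
        {(k, \<phi> i k x \<otimes>\<^bsub>G k\<^esub> \<phi> j k y) | i x j y k.
           (i, x) \<in> A \<and> (j, y) \<in> B \<and> k \<in> I \<and> rel i k \<and> rel j k}),
     monoid.one = dirlim_rel I rel G \<phi> `` {(i, \<one>\<^bsub>G i\<^esub>) | i. i \<in> I}\<rparr>"

definition dirlim_in :: "'i set \<Rightarrow> ('i \<Rightarrow> 'i \<Rightarrow> bool) \<Rightarrow> ('i \<Rightarrow> ('a, 'm) monoid_scheme)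
    \<Rightarrow> ('i \<Rightarrow> 'i \<Rightarrow> 'a \<Rightarrow> 'a) \<Rightarrow> 'i \<Rightarrow> 'a \<Rightarrow> ('i \<times> 'a) set" where
  "dirlim_in I rel G \<phi> i x = dirlim_rel I rel G \<phi> `` {(i, x)}"

end

(* The vertex support of a configuration lies in a hereditary saturated set H iff that of any
   congruent configuration does: a vertex lies in H iff all its successors do, and the sink always
   does. Hence SP(E_H) consists of the classes of SP(E) supported in H, it is an order-ideal, and an
   order-ideal is recovered from its vertices, which form a hereditary saturated set because
   |s^{-1}(v)| v and the sum of the successors of v are the same element. The units form an
   order-ideal, hence the smallest one. A hereditary saturated set without some vertex v that connects
   to no cycle would also miss a successor of v, and so on, an infinite walk that is impossible in a
   finite graph; so the vertices that connect to no cycle form the smallest such set. The direct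
   limit is attained at the greatest index H = E^0. Finally SP(E) is finite, as toppling strictly
   decreases a suitable weight, and in a finite commutative monoid each element divides the sum of
   all idempotents since it has an idempotent multiple. *)

theory Submission
  imports Defs
begin

text \<open>The congruence is generated by steps in both directions, so comparing SP(E_H) with SP(E)
  calls for control over derivations that might leave H and return. Support invariance of each
  generating pair rules this out, and the class of a configuration over H is then literally the same
  set of multisets in both monoids. All natural maps are therefore identities on classes, which
  turns injectivity, the laws of the direct system and the comparison of ideals into facts about
  subsets of a single carrier. The order-ideal property also yields the maximal subgroup clause: u +
  t = z_H forces u and t into SP(E_H), so the unit group at z_H is the same in SP(E_H) and in SP(E).
  For finiteness it is enough that every class has some reduced representative. It is proved for E
  alone and inherited by SP(E_H) through inclusion.\<close>

section \<open>Order-ideals of commutative monoids\<close>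

text \<open>The last fact merges closure under sums with the defining property of an order-ideal, so
  that membership of a sum can be rewritten in both directions.\<close>

lemma order_idealD:
  assumes "order_ideal I M"
  shows "I \<subseteq> carrier M" "\<one>\<^bsub>M\<^esub> \<in> I" "submonoid I M"
    and "x \<in> carrier M \<Longrightarrow> y \<in> carrier M \<Longrightarrow> x \<otimes>\<^bsub>M\<^esub> y \<in> I \<longleftrightarrow> x \<in> I \<and> y \<in> I"
proof -
  interpret submonoid I M
    using assms by (simp add: order_ideal_def)
  show "I \<subseteq> carrier M" "\<one>\<^bsub>M\<^esub> \<in> I" "submonoid I M"
    by (fact subset one_closed submonoid_axioms)+
  show "x \<in> carrier M \<Longrightarrow> y \<in> carrier M \<Longrightarrow> x \<otimes>\<^bsub>M\<^esub> y \<in> I \<longleftrightarrow> x \<in> I \<and> y \<in> I"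
    using assms m_closed[of x y] unfolding order_ideal_def by blast
qed

lemma (in monoid) order_idealI:
  assumes "I \<subseteq> carrier G" "\<one> \<in> I"
    and "\<And>x y. x \<in> carrier G \<Longrightarrow> y \<in> carrier G \<Longrightarrow> x \<otimes> y \<in> I \<longleftrightarrow> x \<in> I \<and> y \<in> I"
  shows "order_ideal I G"
proof -
  have "submonoid I G"
    using assms by unfold_locales blast+
  moreover have "\<forall>x\<in>carrier G. \<forall>y\<in>carrier G. x \<otimes> y \<in> I \<longrightarrow> x \<in> I \<and> y \<in> I"
    using assms(3) by blast
  ultimately show ?thesis
    unfolding order_ideal_def ..
qed

context comm_monoid
begin

text \<open>If x + y has inverse w, then y + w is inverse to x.\<close>

lemma order_ideal_Units: "order_ideal (Units G) G"
proof (rule order_idealI)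
  show "x \<otimes> y \<in> Units G \<longleftrightarrow> x \<in> Units G \<and> y \<in> Units G" if "x \<in> carrier G" "y \<in> carrier G" for x y
    using that unit_factor[of x y] unit_factor[of y x] by (auto simp: m_comm)
qed auto

text \<open>The element 0 = x + (-x) lies in I, and so does its summand x.\<close>

lemma Units_subset_order_ideal:
  assumes "order_ideal I G"
  shows "Units G \<subseteq> I"
proof
  fix x
  assume "x \<in> Units G"
  then have "x \<in> carrier G" "inv x \<in> carrier G" "x \<otimes> inv x = \<one>"
    by (simp_all add: Units_closed)
  then show "x \<in> I"
    using order_idealD[OF assms] by metis
qed

lemma order_ideal_finprod:
  assumes "order_ideal I G" "f \<in> A \<rightarrow> I"
  shows "finprod G f A \<in> I"
  using assms(2)
proof (induction A rule: infinite_finite_induct)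
  case (insert a A)
  then have "f \<in> A \<rightarrow> carrier G" "f a \<in> carrier G"
    using order_idealD(1)[OF assms(1)] by auto
  with insert show ?case
    using order_idealD(4)[OF assms(1)] by simp
qed (simp_all add: order_idealD(2)[OF assms(1)])

lemma order_ideal_gen_subset:
  assumes "order_ideal I G" "X \<subseteq> I"
  shows "order_ideal_gen G X \<subseteq> I"
proof
  fix m
  assume "m \<in> order_ideal_gen G X"
  then obtain n :: nat and x where m: "m \<in> carrier G"
    and x: "x \<in> {1..n} \<rightarrow> X" "m divides (\<Otimes>i \<in> {1..n}. x i)"
    unfolding order_ideal_gen_def by blast
  then obtain c where "c \<in> carrier G" "(\<Otimes>i \<in> {1..n}. x i) = m \<otimes> c"
    by (elim dividesE)
  moreover have "(\<Otimes>i \<in> {1..n}. x i) \<in> I"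
    using x assms(2) by (intro order_ideal_finprod[OF assms(1)]) auto
  ultimately show "m \<in> I"
    using order_idealD(4)[OF assms(1)] m by simp
qed

text \<open>\<open>order_ideal_gen\<close> speaks of sums over index sets {1..n}; bounding a + b by
  such a sum needs the concatenation of two families, the second one shifted by n.\<close>

lemma finprod_append:
  fixes n k :: nat
  assumes "x \<in> {1..n} \<rightarrow> carrier G" "y \<in> {1..k} \<rightarrow> carrier G"
  shows "(\<Otimes>i \<in> {1..n + k}. if i \<le> n then x i else y (i - n))
    = (\<Otimes>i \<in> {1..n}. x i) \<otimes> (\<Otimes>i \<in> {1..k}. y i)"
proof -
  define z where "z i = (if i \<le> n then x i else y (i - n))" for i
  have *: "z \<in> {1..n} \<rightarrow> carrier G" "z \<in> (\<lambda>i. i + n) ` {1..k} \<rightarrow> carrier G"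
    using assms by (fastforce simp: z_def Pi_iff)+
  have "{1..n + k} = {1..n} \<union> (\<lambda>i. i + n) ` {1..k}"
    by (auto simp: image_iff)
  then have "finprod G z {1..n + k} = finprod G z {1..n} \<otimes> finprod G z ((\<lambda>i. i + n) ` {1..k})"
    using * by (simp only:) (rule finprod_Un_disjoint, auto)
  also have "finprod G z ((\<lambda>i. i + n) ` {1..k}) = finprod G (\<lambda>i. z (i + n)) {1..k}"
    using * by (intro finprod_reindex) (auto simp: inj_on_def)
  also have "\<dots> = finprod G y {1..k}"
    using assms by (intro finprod_cong') (auto simp: z_def)
  also have "finprod G z {1..n} = finprod G x {1..n}"
    using assms by (intro finprod_cong') (auto simp: z_def)
  finally show ?thesis
    by (simp only: z_def)
qed

lemma order_ideal_order_ideal_gen: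
  assumes "X \<subseteq> carrier G" "X \<noteq> {}"
  shows "order_ideal (order_ideal_gen G X) G" "X \<subseteq> order_ideal_gen G X"
proof -
  have prod_closed: "(\<Otimes>i \<in> {1..n}. x i) \<in> carrier G" if "x \<in> {1..n::nat} \<rightarrow> X" for x n
    using that assms(1) by (intro finprod_closed) auto
  show sub: "X \<subseteq> order_ideal_gen G X"
  proof
    fix v
    assume "v \<in> X"
    then have "v \<in> carrier G" "(\<lambda>_. v) \<in> {1..1::nat} \<rightarrow> X" "v divides (\<Otimes>i \<in> {1..1::nat}. v)"
      using assms(1) by auto
    then show "v \<in> order_ideal_gen G X"
      unfolding order_ideal_gen_def by blast
  qed
  show "order_ideal (order_ideal_gen G X) G"
  proof (rule order_idealI)
    show "order_ideal_gen G X \<subseteq> carrier G"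
      unfolding order_ideal_gen_def by blast
  next
    \<comment> \<open>The generated ideal counts only sums with n \<ge> 1 terms, so 0 has to be
      placed below an actual generator.\<close>
    obtain v where v: "v \<in> X"
      using assms(2) by blast
    then have "\<one> divides (\<Otimes>i \<in> {1..1::nat}. v)" "(\<lambda>_. v) \<in> {1..1::nat} \<rightarrow> X"
      using assms(1) by (auto intro!: dividesI[of v])
    then show "\<one> \<in> order_ideal_gen G X"
      unfolding order_ideal_gen_def by blast
  next
    fix a b
    assume ab: "a \<in> carrier G" "b \<in> carrier G"
    show "a \<otimes> b \<in> order_ideal_gen G X \<longleftrightarrow> a \<in> order_ideal_gen G X \<and> b \<in> order_ideal_gen G X"
    proof (intro iffI)
      assume "a \<otimes> b \<in> order_ideal_gen G X"
      then obtain n :: nat and x where x: "n \<ge> 1" "x \<in> {1..n} \<rightarrow> X"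
        "a \<otimes> b divides (\<Otimes>i \<in> {1..n}. x i)"
        unfolding order_ideal_gen_def by blast
      then obtain c where c: "c \<in> carrier G" "(\<Otimes>i \<in> {1..n}. x i) = a \<otimes> b \<otimes> c"
        by (elim dividesE)
      have "a divides (\<Otimes>i \<in> {1..n}. x i)"
        using ab c by (intro dividesI[of "b \<otimes> c"]) (auto simp: m_assoc)
      moreover have "b divides (\<Otimes>i \<in> {1..n}. x i)"
        using ab c by (intro dividesI[of "a \<otimes> c"]) (auto simp: m_ac)
      ultimately show "a \<in> order_ideal_gen G X \<and> b \<in> order_ideal_gen G X"
        using x ab unfolding order_ideal_gen_def by blast
    next
      assume "a \<in> order_ideal_gen G X \<and> b \<in> order_ideal_gen G X"
      then obtain n k :: nat and x y where x: "n \<ge> 1" "x \<in> {1..n} \<rightarrow> X"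
          "a divides (\<Otimes>i \<in> {1..n}. x i)"
        and y: "k \<ge> 1" "y \<in> {1..k} \<rightarrow> X" "b divides (\<Otimes>i \<in> {1..k}. y i)"
        unfolding order_ideal_gen_def by blast
      define z where "z i = (if i \<le> n then x i else y (i - n))" for i
      have z: "z \<in> {1..n + k} \<rightarrow> X" "n + k \<ge> 1"
        using x(1,2) y(2) by (fastforce simp: z_def Pi_iff)+
      have "(\<Otimes>i \<in> {1..n + k}. z i) = (\<Otimes>i \<in> {1..n}. x i) \<otimes> (\<Otimes>i \<in> {1..k}. y i)"
        unfolding z_def using x y assms(1) by (intro finprod_append) auto
      moreover obtain c where "c \<in> carrier G" "(\<Otimes>i \<in> {1..n}. x i) = a \<otimes> c"
        using x(3) by (elim dividesE)
      moreover obtain d where "d \<in> carrier G" "(\<Otimes>i \<in> {1..k}. y i) = b \<otimes> d"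
        using y(3) by (elim dividesE)
      ultimately have "a \<otimes> b divides (\<Otimes>i \<in> {1..n + k}. z i)"
        using ab by (intro dividesI[of "c \<otimes> d"]) (auto simp: m_ac)
      with z ab show "a \<otimes> b \<in> order_ideal_gen G X"
        unfolding order_ideal_gen_def by blast
    qed
  qed
qed

end

section \<open>Grothendieck groups\<close>

text \<open>Operations on quotients are defined by saturating the set of all results on
  representatives. This collapses such a saturation to the class of one result once all results are
  known to be equivalent to it.\<close>

lemma equiv_Image_subset_class:
  assumes "equiv A r" "S \<subseteq> r `` {x}" "x \<in> S"
  shows "r `` S = r `` {x}"
proof
  show "r `` S \<subseteq> r `` {x}"
    using assms(2) equivE[OF assms(1)] by (blast dest: transD)
  show "r `` {x} \<subseteq> r `` S"
    using assms(3) by blast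
qed

context comm_monoid
begin

lemma groth_rel_iff:
  "((a, b), (c, d)) \<in> groth_rel G \<longleftrightarrow> a \<in> carrier G \<and> b \<in> carrier G \<and> c \<in> carrier G \<and> d \<in> carrier G
     \<and> (\<exists>x \<in> carrier G. a \<otimes> d \<otimes> x = b \<otimes> c \<otimes> x)"
  by (simp add: groth_rel_def)

lemma equiv_groth_rel: "equiv (carrier G \<times> carrier G) (groth_rel G)"
proof (rule equivI)
  show "groth_rel G \<subseteq> (carrier G \<times> carrier G) \<times> carrier G \<times> carrier G"
    by (auto simp: groth_rel_iff)
  show "refl_on (carrier G \<times> carrier G) (groth_rel G)"
    by (rule refl_onI) (auto simp: groth_rel_iff m_comm)
  show "sym (groth_rel G)"
    by (rule symI) (clarsimp simp: groth_rel_iff, metis m_comm)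
  show "trans (groth_rel G)"
  proof (rule transI, clarsimp simp: groth_rel_iff)
    fix a b c d e f x y
    assume car: "a \<in> carrier G" "b \<in> carrier G" "c \<in> carrier G" "d \<in> carrier G" "e \<in> carrier G"
        "f \<in> carrier G" "x \<in> carrier G" "y \<in> carrier G"
      and eq: "a \<otimes> d \<otimes> x = b \<otimes> c \<otimes> x" "c \<otimes> f \<otimes> y = d \<otimes> e \<otimes> y"
    \<comment> \<open>Without cancellation, c and d survive the addition of the two equations; they
      are moved into the witness.\<close>
    have "a \<otimes> f \<otimes> (c \<otimes> d \<otimes> x \<otimes> y) = (a \<otimes> d \<otimes> x) \<otimes> (c \<otimes> f \<otimes> y)"
      using car by (simp add: m_ac)
    also have "\<dots> = b \<otimes> e \<otimes> (c \<otimes> d \<otimes> x \<otimes> y)"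
      unfolding eq using car by (simp add: m_ac)
    finally show "\<exists>z\<in>carrier G. a \<otimes> f \<otimes> z = b \<otimes> e \<otimes> z"
      using car by (intro bexI[of _ "c \<otimes> d \<otimes> x \<otimes> y"]) auto
  qed
qed

lemma mem_groth_class_iff:
  "(c, d) \<in> groth_class G a b \<longleftrightarrow> ((a, b), (c, d)) \<in> groth_rel G"
  by (simp add: groth_class_def)

lemma groth_class_eq_iff:
  assumes "a \<in> carrier G" "b \<in> carrier G" "c \<in> carrier G" "d \<in> carrier G"
  shows "groth_class G a b = groth_class G c d \<longleftrightarrow> (\<exists>x \<in> carrier G. a \<otimes> d \<otimes> x = b \<otimes> c \<otimes> x)"
  unfolding groth_class_def
  using eq_equiv_class_iff[OF equiv_groth_rel, of "(a, b)" "(c, d)"] assms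
  by (simp add: groth_rel_iff)

lemma carrier_grothendieck:
  "carrier (grothendieck G) = (\<lambda>(a, b). groth_class G a b) ` (carrier G \<times> carrier G)"
  by (auto simp: grothendieck_def groth_class_def quotient_def)

lemma groth_class_closed:
  "a \<in> carrier G \<Longrightarrow> b \<in> carrier G \<Longrightarrow> groth_class G a b \<in> carrier (grothendieck G)"
  by (auto simp: carrier_grothendieck)

lemma groth_class_mult:
  assumes "a \<in> carrier G" "b \<in> carrier G" "c \<in> carrier G" "d \<in> carrier G"
  shows "groth_class G a b \<otimes>\<^bsub>grothendieck G\<^esub> groth_class G c d = groth_class G (a \<otimes> c) (b \<otimes> d)"
proof -
  have "groth_rel G `` {(a1 \<otimes> b1, a2 \<otimes> b2) | a1 a2 b1 b2.
      (a1, a2) \<in> groth_class G a b \<and> (b1, b2) \<in> groth_class G c d}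
    = groth_rel G `` {(a \<otimes> c, b \<otimes> d)}"
  proof (rule equiv_Image_subset_class[OF equiv_groth_rel], rule subsetI)
    fix p
    assume "p \<in> {(a1 \<otimes> b1, a2 \<otimes> b2) | a1 a2 b1 b2.
      (a1, a2) \<in> groth_class G a b \<and> (b1, b2) \<in> groth_class G c d}"
    then obtain a' b' c' d' x y where p: "p = (a' \<otimes> c', b' \<otimes> d')"
      and car: "a' \<in> carrier G" "b' \<in> carrier G" "c' \<in> carrier G" "d' \<in> carrier G"
        "x \<in> carrier G" "y \<in> carrier G"
      and eq: "a \<otimes> b' \<otimes> x = b \<otimes> a' \<otimes> x" "c \<otimes> d' \<otimes> y = d \<otimes> c' \<otimes> y"
      by (auto simp: mem_groth_class_iff groth_rel_iff)
    have "a \<otimes> c \<otimes> (b' \<otimes> d') \<otimes> (x \<otimes> y) = (a \<otimes> b' \<otimes> x) \<otimes> (c \<otimes> d' \<otimes> y)"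
      using car assms by (simp add: m_ac)
    also have "\<dots> = b \<otimes> d \<otimes> (a' \<otimes> c') \<otimes> (x \<otimes> y)"
      unfolding eq using car assms by (simp add: m_ac)
    finally show "p \<in> groth_rel G `` {(a \<otimes> c, b \<otimes> d)}"
      using car assms unfolding p Image_singleton_iff groth_rel_iff
      by (intro conjI bexI[of _ "x \<otimes> y"]) auto
  next
    have "((a, b), (a, b)) \<in> groth_rel G" "((c, d), (c, d)) \<in> groth_rel G"
      using assms by (auto simp: groth_rel_iff m_comm)
    then show "(a \<otimes> c, b \<otimes> d) \<in> {(a1 \<otimes> b1, a2 \<otimes> b2) | a1 a2 b1 b2.
      (a1, a2) \<in> groth_class G a b \<and> (b1, b2) \<in> groth_class G c d}"
      unfolding mem_groth_class_iff by blast
  qed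
  then show ?thesis
    by (simp add: grothendieck_def groth_class_def)
qed

lemma one_grothendieck: "\<one>\<^bsub>grothendieck G\<^esub> = groth_class G \<one> \<one>"
proof -
  have "groth_rel G `` {(m, m) | m. m \<in> carrier G} = groth_rel G `` {(\<one>, \<one>)}"
    by (rule equiv_Image_subset_class[OF equiv_groth_rel]) (auto simp: groth_rel_iff)
  then show ?thesis
    by (simp add: grothendieck_def groth_class_def)
qed

lemma comm_group_grothendieck: "comm_group (grothendieck G)"
proof (rule comm_groupI)
  fix X
  assume "X \<in> carrier (grothendieck G)"
  then obtain a b where X: "a \<in> carrier G" "b \<in> carrier G" "X = groth_class G a b"
    by (auto simp: carrier_grothendieck)
  then have "groth_class G b a \<otimes>\<^bsub>grothendieck G\<^esub> X = \<one>\<^bsub>grothendieck G\<^esub>"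
    by (auto simp: groth_class_mult one_grothendieck groth_class_eq_iff m_comm)
  with X show "\<exists>Y\<in>carrier (grothendieck G). Y \<otimes>\<^bsub>grothendieck G\<^esub> X = \<one>\<^bsub>grothendieck G\<^esub>"
    by (blast intro: groth_class_closed)
qed (auto simp: carrier_grothendieck groth_class_mult one_grothendieck m_ac intro!: image_eqI)

end

lemma groth_map_groth_class:
  assumes "comm_monoid M" "comm_monoid N" "f \<in> hom M N" "a \<in> carrier M" "b \<in> carrier M"
  shows "groth_map N f (groth_class M a b) = groth_class N (f a) (f b)"
proof -
  interpret M: comm_monoid M by fact
  interpret N: comm_monoid N by fact
  note f_closed = hom_in_carrier[OF assms(3)]
  have "groth_rel N `` {(f x, f y) | x y. (x, y) \<in> groth_class M a b} = groth_rel N `` {(f a, f b)}"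
  proof (rule equiv_Image_subset_class[OF N.equiv_groth_rel],
      rule subsetI)
    fix p
    assume "p \<in> {(f x, f y) | x y. (x, y) \<in> groth_class M a b}"
    then obtain c d x where p: "p = (f c, f d)"
      and car: "c \<in> carrier M" "d \<in> carrier M" "x \<in> carrier M"
      and "a \<otimes>\<^bsub>M\<^esub> d \<otimes>\<^bsub>M\<^esub> x = b \<otimes>\<^bsub>M\<^esub> c \<otimes>\<^bsub>M\<^esub> x"
      by (auto simp: M.mem_groth_class_iff M.groth_rel_iff)
    then have "f a \<otimes>\<^bsub>N\<^esub> f d \<otimes>\<^bsub>N\<^esub> f x = f b \<otimes>\<^bsub>N\<^esub> f c \<otimes>\<^bsub>N\<^esub> f x" "f x \<in> carrier N"
      using assms(4,5) hom_mult[OF assms(3)] f_closed by (metis M.m_closed)+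
    then show "p \<in> groth_rel N `` {(f a, f b)}"
      using car assms(4,5) f_closed unfolding p Image_singleton_iff N.groth_rel_iff by blast
  next
    show "(f a, f b) \<in> {(f x, f y) | x y. (x, y) \<in> groth_class M a b}"
      using assms(4,5) M.m_comm[of a b] unfolding M.mem_groth_class_iff M.groth_rel_iff
      by (intro CollectI exI[of _ a] exI[of _ b]) auto
  qed
  then show ?thesis
    by (simp add: groth_map_def groth_class_def)
qed

lemma groth_map_hom:
  assumes "comm_monoid M" "comm_monoid N" "f \<in> hom M N"
  shows "groth_map N f \<in> hom (grothendieck M) (grothendieck N)"
proof (rule homI)
  interpret M: comm_monoid M by fact
  interpret N: comm_monoid N by fact
  note f_closed = hom_in_carrier[OF assms(3)]
  show "groth_map N f X \<in> carrier (grothendieck N)" if "X \<in> carrier (grothendieck M)" for X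
    using that
    by (auto simp: M.carrier_grothendieck groth_map_groth_class[OF assms] N.groth_class_closed f_closed)
  show "groth_map N f (X \<otimes>\<^bsub>grothendieck M\<^esub> Y)
      = groth_map N f X \<otimes>\<^bsub>grothendieck N\<^esub> groth_map N f Y"
    if "X \<in> carrier (grothendieck M)" "Y \<in> carrier (grothendieck M)" for X Y
    using that
    by (auto simp: M.carrier_grothendieck M.groth_class_mult N.groth_class_mult
        groth_map_groth_class[OF assms] f_closed hom_mult[OF assms(3)])
qed

section \<open>Finite commutative monoids\<close>

text \<open>Powers in a finite monoid repeat: from some exponent i on they have a period d. If n
  \<ge> i is a positive multiple of d, doubling n shifts it by whole periods.\<close>

lemma (in monoid) finite_imp_idempotent_power:
  assumes "finite (carrier G)" "x \<in> carrier G"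
  obtains n :: nat where "n \<noteq> 0" "x [^] n \<in> idempotents G"
proof -
  have "\<not> inj (\<lambda>n::nat. x [^] n)"
    using assms by (metis finite_subset image_subsetI infinite_UNIV_nat nat_pow_closed
        finite_imageD)
  then obtain i j :: nat where "i < j" "x [^] i = x [^] j"
    by (metis injI linorder_neqE_nat)
  then obtain d where d: "d \<noteq> 0" "x [^] (i + d) = x [^] i"
    by (metis less_imp_add_positive less_numeral_extra(3))
  have shift: "x [^] (i + k + d) = x [^] (i + k)" for k
    using assms(2) d(2) by (metis add.commute add.left_commute nat_pow_mult)
  have period: "x [^] (i + k + m * d) = x [^] (i + k)" for k m
  proof (induction m)
    case (Suc m)
    then show ?case
      using shift[of "k + m * d"] by (simp add: algebra_simps)
  qed simp
  \<comment> \<open>The factor i + 1 makes this multiple of d nonzero and at least i, also when i =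
    0.\<close>
  define n where "n = (i + 1) * d"
  have "i \<le> n"
    using d(1) unfolding n_def by (metis Suc_eq_plus1 Suc_leD mult_le_mono2 mult.right_neutral
        One_nat_def Suc_leI neq0_conv)
  then have "x [^] (n + n) = x [^] n"
    using period[of "n - i" "i + 1"] by (simp add: n_def)
  then have "x [^] n \<in> idempotents G"
    using assms(2) by (simp add: idempotents_def nat_pow_mult)
  moreover have "n \<noteq> 0"
    using d(1) by (simp add: n_def)
  ultimately show thesis
    using that by blast
qed

lemma mem_l_coset_iff: "y \<in> x <#\<^bsub>M\<^esub> A \<longleftrightarrow> (\<exists>a\<in>A. y = x \<otimes>\<^bsub>M\<^esub> a)"
  by (auto simp: l_coset_def)

locale finite_comm_monoid = comm_monoid +
  assumes finite_carrier: "finite (carrier G)"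
begin

text \<open>The element z of the statement. By \<open>idem_prod_factor\<close> it is a multiple of
  every element, which makes it the identity of the smallest ideal.\<close>

definition idem_prod :: 'a where
  "idem_prod = (\<Otimes>x \<in> idempotents G. x)"

lemma finite_idempotents: "finite (idempotents G)"
  using finite_carrier by (rule rev_finite_subset) (auto simp: idempotents_def)

lemma idem_prod_idempotent: "idem_prod \<in> idempotents G"
proof -
  have *: "(\<lambda>x. x) \<in> idempotents G \<rightarrow> carrier G"
    by (auto simp: idempotents_def)
  have "idem_prod \<otimes> idem_prod = (\<Otimes>x \<in> idempotents G. x \<otimes> x)"
    unfolding idem_prod_def using finprod_multf[OF * *] by simp
  also have "\<dots> = idem_prod"
    unfolding idem_prod_def by (rule finprod_cong') (auto simp: idempotents_def)
  finally show ?thesis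
    using finprod_closed[OF *] by (simp add: idempotents_def idem_prod_def)
qed

lemma idem_prod_closed: "idem_prod \<in> carrier G"
  and idem_prod_idem: "idem_prod \<otimes> idem_prod = idem_prod"
  using idem_prod_idempotent by (auto simp: idempotents_def)

text \<open>Every element has an idempotent power, which is one of the factors of \<^term>\<open>idem_prod\<close>.\<close>

lemma idem_prod_factor:
  assumes "c \<in> carrier G"
  obtains t where "t \<in> carrier G" "idem_prod = c \<otimes> t"
proof -
  obtain n :: nat where n: "n \<noteq> 0" "c [^] n \<in> idempotents G"
    using finite_imp_idempotent_power[OF finite_carrier assms] .
  have *: "(\<lambda>x. x) \<in> A \<rightarrow> carrier G" if "A \<subseteq> idempotents G" for A
    using that by (auto simp: idempotents_def)
  have "idem_prod = finprod G (\<lambda>x. x) (insert (c [^] n) (idempotents G - {c [^] n}))"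
    using n(2) by (simp add: idem_prod_def insert_absorb)
  also have "\<dots> = c [^] n \<otimes> finprod G (\<lambda>x. x) (idempotents G - {c [^] n})"
    using finite_idempotents assms by (intro finprod_insert *) auto
  finally have eq: "idem_prod = c [^] n \<otimes> finprod G (\<lambda>x. x) (idempotents G - {c [^] n})" .
  have closed: "finprod G (\<lambda>x. x) (idempotents G - {c [^] n}) \<in> carrier G"
    by (intro finprod_closed *) blast
  have "c [^] n = c \<otimes> c [^] (n - 1)"
    using n(1) assms by (metis Suc_pred' neq0_conv nat_pow_Suc2)
  with eq have "idem_prod = c \<otimes> (c [^] (n - 1) \<otimes> finprod G (\<lambda>x. x) (idempotents G - {c [^] n}))"
    using assms closed by (metis m_assoc nat_pow_closed)
  then show thesis
    using assms closed by (intro that[of "c [^] (n - 1) \<otimes> finprod G (\<lambda>x. x) (idempotents G - {c [^] n})"]) auto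
qed

lemma idem_prod_absorb: "x \<in> idem_prod <# carrier G \<Longrightarrow> idem_prod \<otimes> x = x"
  using idem_prod_closed idem_prod_idem by (auto simp: mem_l_coset_iff simp flip: m_assoc)

text \<open>A recurrent element is in particular a multiple of z. Conversely every c divides z,
  hence divides each z + x.\<close>

lemma recurrent_eq: "recurrent G = idem_prod <# carrier G"
proof (intro equalityI subsetI)
  fix a
  assume "a \<in> recurrent G"
  then show "a \<in> idem_prod <# carrier G"
    using idem_prod_closed by (auto simp: recurrent_def mem_l_coset_iff)
next
  fix a
  assume "a \<in> idem_prod <# carrier G"
  then obtain x where x: "x \<in> carrier G" "a = idem_prod \<otimes> x"
    by (auto simp: mem_l_coset_iff)
  have "\<exists>y\<in>carrier G. a = c \<otimes> y" if "c \<in> carrier G" for c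
    using idem_prod_factor[OF that] x that by (metis m_assoc m_closed)
  then show "a \<in> recurrent G"
    using x idem_prod_closed by (auto simp: recurrent_def)
qed

text \<open>By \<open>recurrent_eq\<close> the left side is all of z + M, so this says that z + M is
  a group: u divides z, and if z = u + t, then z + t is the inverse of u.\<close>

lemma recurrent_eq_Units: "recurrent G = Units (idem_monoid G idem_prod)"
proof (intro equalityI subsetI)
  fix u
  assume "u \<in> recurrent G"
  then have u: "u \<in> idem_prod <# carrier G" "u \<in> carrier G"
    using recurrent_eq by (auto simp: recurrent_def)
  obtain t where t: "t \<in> carrier G" "idem_prod = u \<otimes> t"
    using idem_prod_factor[OF u(2)] .
  have "u \<otimes> (idem_prod \<otimes> t) = idem_prod \<otimes> (u \<otimes> t)"
    using u t(1) idem_prod_closed by (simp add: m_ac)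
  also have "\<dots> = idem_prod"
    using t(2) idem_prod_idem by simp
  finally have "u \<otimes> (idem_prod \<otimes> t) = idem_prod" "idem_prod \<otimes> t \<otimes> u = idem_prod"
    using u t(1) idem_prod_closed by (simp_all add: m_comm)
  moreover have "idem_prod \<otimes> t \<in> idem_prod <# carrier G"
    using t(1) by (auto simp: mem_l_coset_iff)
  ultimately show "u \<in> Units (idem_monoid G idem_prod)"
    using u(1) by (auto simp: Units_def idem_monoid_def)
qed (auto simp: recurrent_eq Units_def idem_monoid_def)

text \<open>Injectivity: a witness c with x + c = y + c can be enlarged to z, which acts as 0 on z +
  M. Surjectivity: if z = b + t, then z + t plays the role of -b, so that [(a, b)] comes from z + a
  + t.\<close>

lemma groth_class_iso:
  "(\<lambda>x. groth_class G x \<one>) \<in> iso (idem_monoid G idem_prod) (grothendieck G)"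
proof (rule isoI)
  let ?A = "idem_prod <# carrier G"
  have sub: "?A \<subseteq> carrier G"
    using idem_prod_closed by (auto simp: mem_l_coset_iff)
  show "(\<lambda>x. groth_class G x \<one>) \<in> hom (idem_monoid G idem_prod) (grothendieck G)"
    using sub by (intro homI) (simp_all add: idem_monoid_def groth_class_closed groth_class_mult subset_iff)
  have "inj_on (\<lambda>x. groth_class G x \<one>) ?A"
  proof (rule inj_onI)
    fix x y
    assume xy: "x \<in> ?A" "y \<in> ?A" and "groth_class G x \<one> = groth_class G y \<one>"
    then have xy_closed: "x \<in> carrier G" "y \<in> carrier G"
      using sub by auto
    with \<open>groth_class G x \<one> = groth_class G y \<one>\<close>
    obtain c where c: "c \<in> carrier G" "x \<otimes> c = y \<otimes> c"
      by (auto simp: groth_class_eq_iff)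
    obtain t where "t \<in> carrier G" "idem_prod = c \<otimes> t"
      using idem_prod_factor[OF c(1)] .
    then have "x \<otimes> idem_prod = y \<otimes> idem_prod"
      using c xy_closed by (simp flip: m_assoc)
    then show "x = y"
      using xy xy_closed idem_prod_absorb idem_prod_closed by (metis m_comm)
  qed
  moreover have "X \<in> (\<lambda>x. groth_class G x \<one>) ` ?A" if "X \<in> carrier (grothendieck G)" for X
  proof -
    obtain a b where ab: "a \<in> carrier G" "b \<in> carrier G" "X = groth_class G a b"
      using \<open>X \<in> carrier (grothendieck G)\<close> by (auto simp: carrier_grothendieck)
    obtain t where t: "t \<in> carrier G" "idem_prod = b \<otimes> t"
      using idem_prod_factor[OF ab(2)] .
    have "a \<otimes> \<one> \<otimes> idem_prod = a \<otimes> (idem_prod \<otimes> idem_prod)"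
      using ab idem_prod_closed idem_prod_idem by simp
    also have "\<dots> = b \<otimes> (idem_prod \<otimes> (a \<otimes> t)) \<otimes> \<one>"
      using ab t(1) idem_prod_closed by (subst (2) t(2)) (simp add: m_ac)
    also have "\<dots> = b \<otimes> (idem_prod \<otimes> (a \<otimes> t)) \<otimes> idem_prod"
      using ab t(1) idem_prod_closed idem_prod_idem by (simp add: m_ac)
    finally have "X = groth_class G (idem_prod \<otimes> (a \<otimes> t)) \<one>"
      using ab t(1) idem_prod_closed by (auto simp: groth_class_eq_iff)
    then show ?thesis
      using ab t(1) by (intro image_eqI[where x = "idem_prod \<otimes> (a \<otimes> t)"]) (auto simp: mem_l_coset_iff)
  qed
  ultimately show "bij_betw (\<lambda>x. groth_class G x \<one>) (carrier (idem_monoid G idem_prod))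
      (carrier (grothendieck G))"
    using sub by (auto simp: bij_betw_def idem_monoid_def groth_class_closed)
qed

end

text \<open>Two elements of N with sum z lie in the order-ideal M because z does, so inverses
  relative to z never leave M. This transports the unit group at z from a restriction to all of
  SP(E).\<close>

lemma Units_idem_monoid_order_ideal:
  assumes "order_ideal (carrier M) N" "z \<in> carrier M" "z \<otimes>\<^bsub>N\<^esub> z = z" "comm_monoid N"
    and mult: "\<And>x y. x \<in> carrier M \<Longrightarrow> y \<in> carrier M \<Longrightarrow> x \<otimes>\<^bsub>M\<^esub> y = x \<otimes>\<^bsub>N\<^esub> y"
  shows "Units (idem_monoid N z) = Units (idem_monoid M z)"
proof -
  interpret N: comm_monoid N by fact
  note I = order_idealD[OF assms(1)]
  have sub: "x \<in> z <#\<^bsub>M\<^esub> carrier M \<longleftrightarrow> x \<in> z <#\<^bsub>N\<^esub> carrier N \<and> x \<in> carrier M" for x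
  proof
    assume "x \<in> z <#\<^bsub>M\<^esub> carrier M"
    then obtain c where "c \<in> carrier M" "x = z \<otimes>\<^bsub>N\<^esub> c"
      using mult[OF assms(2)] by (auto simp: mem_l_coset_iff)
    then show "x \<in> z <#\<^bsub>N\<^esub> carrier N \<and> x \<in> carrier M"
      using I assms(2) by (auto simp: mem_l_coset_iff)
  next
    assume x: "x \<in> z <#\<^bsub>N\<^esub> carrier N \<and> x \<in> carrier M"
    then obtain c where c: "c \<in> carrier N" "x = z \<otimes>\<^bsub>N\<^esub> c"
      by (auto simp: mem_l_coset_iff)
    then have "c \<in> carrier M"
      using x I assms(2) by blast
    then show "x \<in> z <#\<^bsub>M\<^esub> carrier M"
      using c mult[OF assms(2)] by (auto simp: mem_l_coset_iff)
  qed
  have "u \<in> carrier M \<and> t \<in> carrier M" if "u \<in> carrier N" "t \<in> carrier N" "u \<otimes>\<^bsub>N\<^esub> t = z" for u t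
    using that I assms(2) by blast
  moreover have "z <#\<^bsub>N\<^esub> carrier N \<subseteq> carrier N"
    using I(1) assms(2) by (auto simp: mem_l_coset_iff subset_iff)
  ultimately have "u \<in> carrier M \<and> t \<in> carrier M"
    if "u \<in> z <#\<^bsub>N\<^esub> carrier N" "t \<in> z <#\<^bsub>N\<^esub> carrier N" "u \<otimes>\<^bsub>N\<^esub> t = z" for u t
    using that by blast
  then have "u \<in> z <#\<^bsub>N\<^esub> carrier N \<and> (\<exists>t \<in> z <#\<^bsub>N\<^esub> carrier N. t \<otimes>\<^bsub>N\<^esub> u = z \<and> u \<otimes>\<^bsub>N\<^esub> t = z) \<longleftrightarrow>
      u \<in> z <#\<^bsub>M\<^esub> carrier M \<and> (\<exists>t \<in> z <#\<^bsub>M\<^esub> carrier M. t \<otimes>\<^bsub>M\<^esub> u = z \<and> u \<otimes>\<^bsub>M\<^esub> t = z)" for u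
    using sub mult by (metis (no_types, lifting))
  then show ?thesis
    unfolding Units_def idem_monoid_def by simp
qed

section \<open>Lattices of sets\<close>

lemma partial_order_inclusion: "partial_order (inclusion_order A)"
  by unfold_locales (auto simp: inclusion_order_def)

lemma inclusion_order_simps [simp]:
  "carrier (inclusion_order A) = A" "X \<sqsubseteq>\<^bsub>inclusion_order A\<^esub> Y \<longleftrightarrow> X \<subseteq> Y"
  by (simp_all add: inclusion_order_def)

lemma inclusion_join:
  assumes "X \<in> A" "Y \<in> A" "C \<in> A" "X \<union> Y \<subseteq> C" "\<And>D. D \<in> A \<Longrightarrow> X \<union> Y \<subseteq> D \<Longrightarrow> C \<subseteq> D"
  shows "least (inclusion_order A) C (Upper (inclusion_order A) {X, Y})"
    and "X \<squnion>\<^bsub>inclusion_order A\<^esub> Y = C"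
proof -
  interpret partial_order "inclusion_order A"
    by (rule partial_order_inclusion)
  show *: "least (inclusion_order A) C (Upper (inclusion_order A) {X, Y})"
    using assms by (auto simp: least_def Upper_def)
  show "X \<squnion>\<^bsub>inclusion_order A\<^esub> Y = C"
    \<comment> \<open>Joins are picked by a choice operator among all least upper bounds, so C has
      to be identified through uniqueness.\<close>
    unfolding join_def Lattice.sup_def by (rule some_equality, rule *) (erule least_unique, rule *)
qed

lemma inclusion_meet:
  assumes "X \<in> A" "Y \<in> A" "C \<in> A" "C \<subseteq> X \<inter> Y" "\<And>D. D \<in> A \<Longrightarrow> D \<subseteq> X \<inter> Y \<Longrightarrow> D \<subseteq> C"
  shows "greatest (inclusion_order A) C (Lower (inclusion_order A) {X, Y})"
    and "X \<sqinter>\<^bsub>inclusion_order A\<^esub> Y = C"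
proof -
  interpret partial_order "inclusion_order A"
    by (rule partial_order_inclusion)
  show *: "greatest (inclusion_order A) C (Lower (inclusion_order A) {X, Y})"
    using assms by (auto simp: greatest_def Lower_def)
  show "X \<sqinter>\<^bsub>inclusion_order A\<^esub> Y = C"
    unfolding meet_def Lattice.inf_def by (rule some_equality, rule *) (erule greatest_unique, rule *)
qed

lemma lattice_inclusionI:
  assumes "\<And>X Y. X \<in> A \<Longrightarrow> Y \<in> A \<Longrightarrow> \<exists>C\<in>A. X \<union> Y \<subseteq> C \<and> (\<forall>D\<in>A. X \<union> Y \<subseteq> D \<longrightarrow> C \<subseteq> D)"
    and "\<And>X Y. X \<in> A \<Longrightarrow> Y \<in> A \<Longrightarrow> \<exists>C\<in>A. C \<subseteq> X \<inter> Y \<and> (\<forall>D\<in>A. D \<subseteq> X \<inter> Y \<longrightarrow> D \<subseteq> C)"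
  shows "lattice (inclusion_order A)"
proof -
  interpret partial_order "inclusion_order A"
    by (rule partial_order_inclusion)
  show ?thesis
  proof unfold_locales
    fix X Y
    assume "X \<in> carrier (inclusion_order A)" "Y \<in> carrier (inclusion_order A)"
    then have XY: "X \<in> A" "Y \<in> A"
      by simp_all
    obtain C where C: "C \<in> A" "X \<union> Y \<subseteq> C" "\<And>D. D \<in> A \<Longrightarrow> X \<union> Y \<subseteq> D \<Longrightarrow> C \<subseteq> D"
      using assms(1)[OF XY] by metis
    show "\<exists>C. least (inclusion_order A) C (Upper (inclusion_order A) {X, Y})"
      by (rule exI, rule inclusion_join(1)[OF XY C])
    obtain C where C: "C \<in> A" "C \<subseteq> X \<inter> Y" "\<And>D. D \<in> A \<Longrightarrow> D \<subseteq> X \<inter> Y \<Longrightarrow> D \<subseteq> C"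
      using assms(2)[OF XY] by metis
    show "\<exists>C. greatest (inclusion_order A) C (Lower (inclusion_order A) {X, Y})"
      by (rule exI, rule inclusion_meet(1)[OF XY C])
  qed
qed

text \<open>Joins and meets are determined by the order, so a bijection that preserves and reflects
  inclusion carries them over. The order-ideals thus form a lattice without any computation of their
  joins.\<close>

lemma lattice_iso_inclusionI:
  assumes "lattice (inclusion_order A)" "bij_betw f A B"
    and mono: "\<And>X Y. X \<in> A \<Longrightarrow> Y \<in> A \<Longrightarrow> f X \<subseteq> f Y \<longleftrightarrow> X \<subseteq> Y"
  shows "lattice (inclusion_order B)"
    and "lattice_iso f (inclusion_order A) (inclusion_order B)"
proof -
  interpret A: lattice "inclusion_order A" by fact
  have B: "B = f ` A"
    using assms(2) by (simp add: bij_betw_def)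
  have join: "f (X \<squnion>\<^bsub>inclusion_order A\<^esub> Y) \<in> B \<and> f X \<union> f Y \<subseteq> f (X \<squnion>\<^bsub>inclusion_order A\<^esub> Y)
      \<and> (\<forall>D\<in>B. f X \<union> f Y \<subseteq> D \<longrightarrow> f (X \<squnion>\<^bsub>inclusion_order A\<^esub> Y) \<subseteq> D)" if "X \<in> A" "Y \<in> A" for X Y
    using that A.join_closed[of X Y] A.join_left[of X Y] A.join_right[of X Y] A.join_le[of X _ Y]
    unfolding B by (auto simp: mono)
  have meet: "f (X \<sqinter>\<^bsub>inclusion_order A\<^esub> Y) \<in> B \<and> f (X \<sqinter>\<^bsub>inclusion_order A\<^esub> Y) \<subseteq> f X \<inter> f Y
      \<and> (\<forall>D\<in>B. D \<subseteq> f X \<inter> f Y \<longrightarrow> D \<subseteq> f (X \<sqinter>\<^bsub>inclusion_order A\<^esub> Y))" if "X \<in> A" "Y \<in> A" for X Y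
    using that A.meet_closed[of X Y] A.meet_left[of X Y] A.meet_right[of X Y] A.meet_le[of _ X Y]
    unfolding B by (auto simp: mono)
  show "lattice (inclusion_order B)"
  proof (rule lattice_inclusionI)
    fix X' Y'
    assume "X' \<in> B" "Y' \<in> B"
    then obtain X Y where XY: "X \<in> A" "Y \<in> A" "X' = f X" "Y' = f Y"
      unfolding B by blast
    show "\<exists>C\<in>B. X' \<union> Y' \<subseteq> C \<and> (\<forall>D\<in>B. X' \<union> Y' \<subseteq> D \<longrightarrow> C \<subseteq> D)"
      using join[OF XY(1,2)] unfolding XY(3,4)
      by (intro bexI[of _ "f (X \<squnion>\<^bsub>inclusion_order A\<^esub> Y)"]) simp_all
    show "\<exists>C\<in>B. C \<subseteq> X' \<inter> Y' \<and> (\<forall>D\<in>B. D \<subseteq> X' \<inter> Y' \<longrightarrow> D \<subseteq> C)"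
      using meet[OF XY(1,2)] unfolding XY(3,4)
      by (intro bexI[of _ "f (X \<sqinter>\<^bsub>inclusion_order A\<^esub> Y)"]) simp_all
  qed
  have "f (X \<squnion>\<^bsub>inclusion_order A\<^esub> Y) = f X \<squnion>\<^bsub>inclusion_order B\<^esub> f Y"
    if "X \<in> A" "Y \<in> A" for X Y
    using that join[OF that] B by (intro inclusion_join(2)[symmetric]) blast+
  moreover have "f (X \<sqinter>\<^bsub>inclusion_order A\<^esub> Y) = f X \<sqinter>\<^bsub>inclusion_order B\<^esub> f Y"
    if "X \<in> A" "Y \<in> A" for X Y
    using that meet[OF that] B by (intro inclusion_meet(2)[symmetric]) blast+
  ultimately show "lattice_iso f (inclusion_order A) (inclusion_order B)"
    using assms(2) by (simp add: lattice_iso_def)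
qed

section \<open>Direct limits over an index set with a greatest element\<close>

context direct_system
begin

lemma hom_mult_map:
  "\<lbrakk>i \<in> I; j \<in> I; rel i j; x \<in> carrier (G i); y \<in> carrier (G i)\<rbrakk>
     \<Longrightarrow> \<phi> i j (x \<otimes>\<^bsub>G i\<^esub> y) = \<phi> i j x \<otimes>\<^bsub>G j\<^esub> \<phi> i j y"
  by (rule hom_mult[OF homs])

lemma map_closed:
  "\<lbrakk>i \<in> I; j \<in> I; rel i j; x \<in> carrier (G i)\<rbrakk> \<Longrightarrow> \<phi> i j x \<in> carrier (G j)"
  by (rule hom_in_carrier[OF homs])

context
  fixes t
  assumes top: "t \<in> I" "\<And>i. i \<in> I \<Longrightarrow> rel i t"
begin

text \<open>An equality reached at some index k persists at t, and t itself is an admissible index;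
  the relation is thus the kernel of the maps into \<open>G t\<close>.\<close>

lemma dirlim_rel_iff:
  "((i, x), (j, y)) \<in> dirlim_rel I rel G \<phi> \<longleftrightarrow>
     i \<in> I \<and> x \<in> carrier (G i) \<and> j \<in> I \<and> y \<in> carrier (G j) \<and> \<phi> i t x = \<phi> j t y"
  unfolding dirlim_rel_def using top map_comp by auto metis

lemma equiv_dirlim_rel: "equiv (SIGMA i:I. carrier (G i)) (dirlim_rel I rel G \<phi>)"
  by (rule equivI) (auto simp: refl_on_def sym_def trans_def dirlim_rel_iff)

lemma dirlim_in_eq_iff:
  assumes "i \<in> I" "x \<in> carrier (G i)" "j \<in> I" "y \<in> carrier (G j)"
  shows "dirlim_in I rel G \<phi> i x = dirlim_in I rel G \<phi> j y \<longleftrightarrow> \<phi> i t x = \<phi> j t y"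
  unfolding dirlim_in_def
  using eq_equiv_class_iff[OF equiv_dirlim_rel, of "(i, x)" "(j, y)"] assms
  by (simp add: dirlim_rel_iff)

lemma carrier_dirlim: "carrier (dirlim I rel G \<phi>) = dirlim_in I rel G \<phi> t ` carrier (G t)"
proof -
  have "carrier (dirlim I rel G \<phi>) = (\<Union>i\<in>I. dirlim_in I rel G \<phi> i ` carrier (G i))"
    by (auto simp: dirlim_def dirlim_in_def quotient_def)
  also have "\<dots> = dirlim_in I rel G \<phi> t ` carrier (G t)"
  proof (intro equalityI subsetI)
    fix X
    assume "X \<in> (\<Union>i\<in>I. dirlim_in I rel G \<phi> i ` carrier (G i))"
    then obtain i x where i: "i \<in> I" "x \<in> carrier (G i)" "X = dirlim_in I rel G \<phi> i x"
      by blast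
    have cl: "\<phi> i t x \<in> carrier (G t)"
      using i top map_closed by blast
    then have "X = dirlim_in I rel G \<phi> t (\<phi> i t x)"
      using i top by (simp add: dirlim_in_eq_iff map_id)
    with cl show "X \<in> dirlim_in I rel G \<phi> t ` carrier (G t)"
      by blast
  qed (use top in blast)
  finally show ?thesis .
qed

lemma dirlim_in_mult:
  assumes "x \<in> carrier (G t)" "y \<in> carrier (G t)"
  shows "dirlim_in I rel G \<phi> t x \<otimes>\<^bsub>dirlim I rel G \<phi>\<^esub> dirlim_in I rel G \<phi> t y
    = dirlim_in I rel G \<phi> t (x \<otimes>\<^bsub>G t\<^esub> y)"
proof -
  interpret Gt: group "G t"
    using groups top by blast
  have closed: "u \<otimes>\<^bsub>G k\<^esub> v \<in> carrier (G k)"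
    if "k \<in> I" "u \<in> carrier (G k)" "v \<in> carrier (G k)" for k u v
    using that groups[of k] by (simp add: group.is_monoid monoid.m_closed)
  have "dirlim_rel I rel G \<phi> `` {(k, \<phi> i k u \<otimes>\<^bsub>G k\<^esub> \<phi> j k v) | i u j v k.
      (i, u) \<in> dirlim_in I rel G \<phi> t x \<and> (j, v) \<in> dirlim_in I rel G \<phi> t y
        \<and> k \<in> I \<and> rel i k \<and> rel j k}
    = dirlim_rel I rel G \<phi> `` {(t, x \<otimes>\<^bsub>G t\<^esub> y)}"
  proof (rule equiv_Image_subset_class[OF equiv_dirlim_rel])
    show "{(k, \<phi> i k u \<otimes>\<^bsub>G k\<^esub> \<phi> j k v) | i u j v k.
      (i, u) \<in> dirlim_in I rel G \<phi> t x \<and> (j, v) \<in> dirlim_in I rel G \<phi> t y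
        \<and> k \<in> I \<and> rel i k \<and> rel j k} \<subseteq> dirlim_rel I rel G \<phi> `` {(t, x \<otimes>\<^bsub>G t\<^esub> y)}"
      \<comment> \<open>Applying \<open>\<phi> k t\<close> to a product formed at k gives the
        product of the images of u and v in \<open>G t\<close>, which are x and y.\<close>
      using assms top
      by (auto simp: dirlim_in_def dirlim_rel_iff map_id closed map_closed hom_mult_map map_comp)
    show "(t, x \<otimes>\<^bsub>G t\<^esub> y) \<in> {(k, \<phi> i k u \<otimes>\<^bsub>G k\<^esub> \<phi> j k v) | i u j v k.
      (i, u) \<in> dirlim_in I rel G \<phi> t x \<and> (j, v) \<in> dirlim_in I rel G \<phi> t y
        \<and> k \<in> I \<and> rel i k \<and> rel j k}"
      using assms top
      by (intro CollectI exI[of _ t] exI[of _ x] exI[of _ y])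
        (auto simp: dirlim_in_def dirlim_rel_iff map_id)
  qed
  then show ?thesis
    by (simp add: dirlim_def dirlim_in_def)
qed

lemma dirlim_iso_top:
  "\<exists>h \<in> iso (dirlim I rel G \<phi>) (G t).
     \<forall>i \<in> I. \<forall>x \<in> carrier (G i). h (dirlim_in I rel G \<phi> i x) = \<phi> i t x"
proof -
  \<comment> \<open>The map (i, x) \<mapsto> \<open>\<phi> i t x\<close> is constant on every class,
    so its image of a class is a singleton.\<close>
  define h where "h X = the_elem ((\<lambda>(i, x). \<phi> i t x) ` X)" for X
  have h: "h (dirlim_in I rel G \<phi> i x) = \<phi> i t x" if "i \<in> I" "x \<in> carrier (G i)" for i x
  proof -
    have "(i, x) \<in> dirlim_in I rel G \<phi> i x"
      using that by (simp add: dirlim_in_def dirlim_rel_iff)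
    then have "(\<lambda>(i, x). \<phi> i t x) ` dirlim_in I rel G \<phi> i x = {\<phi> i t x}"
      by (force simp: dirlim_in_def dirlim_rel_iff)
    then show ?thesis
      by (simp add: h_def)
  qed
  interpret Gt: group "G t"
    using groups top by blast
  have ht: "h (dirlim_in I rel G \<phi> t x) = x" if "x \<in> carrier (G t)" for x
    using that top by (simp add: h map_id)
  have "h \<in> iso (dirlim I rel G \<phi>) (G t)"
  proof (rule isoI)
    show "h \<in> hom (dirlim I rel G \<phi>) (G t)"
      by (rule homI) (auto simp: carrier_dirlim dirlim_in_mult ht)
    show "bij_betw h (carrier (dirlim I rel G \<phi>)) (carrier (G t))"
      by (rule bij_betwI[where g = "dirlim_in I rel G \<phi> t"]) (auto simp: carrier_dirlim ht)
  qed
  with h show ?thesis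
    by blast
qed

end

end

section \<open>Presented commutative monoids\<close>

lemma gen_cong_subset:
  assumes "(a, b) \<in> gen_cong V R"
  shows "set_mset a \<subseteq> V" "set_mset b \<subseteq> V"
  using assms by (induction rule: gen_cong.induct) auto

lemma equiv_gen_cong: "equiv {a. set_mset a \<subseteq> V} (gen_cong V R)"
  by (rule equivI) (auto simp: refl_on_def dest: gen_cong_subset
      intro: gen_cong.refl symI gen_cong.sym transI gen_cong.trans)

lemma carrier_presented_monoid:
  "carrier (presented_monoid V R) = (\<lambda>a. gen_cong V R `` {a}) ` {a. set_mset a \<subseteq> V}"
  by (auto simp: presented_monoid_def quotient_def)

lemma mult_presented_monoid:
  assumes "set_mset a \<subseteq> V" "set_mset b \<subseteq> V"
  shows "gen_cong V R `` {a} \<otimes>\<^bsub>presented_monoid V R\<^esub> gen_cong V R `` {b} = gen_cong V R `` {a + b}"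
proof -
  have "gen_cong V R `` {x + y | x y. x \<in> gen_cong V R `` {a} \<and> y \<in> gen_cong V R `` {b}}
    = gen_cong V R `` {a + b}"
    by (rule equiv_Image_subset_class[OF equiv_gen_cong])
      (use assms in \<open>auto intro: gen_cong.refl gen_cong.add\<close>)
  then show ?thesis
    by (simp add: presented_monoid_def)
qed

lemma one_presented_monoid: "\<one>\<^bsub>presented_monoid V R\<^esub> = gen_cong V R `` {{#}}"
  by (simp add: presented_monoid_def)

lemma comm_monoid_presented_monoid: "comm_monoid (presented_monoid V R)"
  by (rule comm_monoidI)
    (auto simp: carrier_presented_monoid one_presented_monoid mult_presented_monoid ac_simps)

text \<open>Each generating pair has either both sides or neither side over H, and this passes
  through all closure rules. A derivation that starts over H therefore stays over H and uses only
  pairs retained in S.\<close>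

lemma gen_cong_restrict:
  assumes "H \<subseteq> V" "S \<subseteq> R"
    and invariant: "\<And>a b. (a, b) \<in> R \<Longrightarrow> set_mset a \<subseteq> H \<longleftrightarrow> set_mset b \<subseteq> H"
    and retain: "\<And>a b. (a, b) \<in> R \<Longrightarrow> set_mset a \<subseteq> H \<Longrightarrow> (a, b) \<in> S"
  shows "(a, b) \<in> gen_cong V R \<Longrightarrow> set_mset a \<subseteq> H \<longleftrightarrow> set_mset b \<subseteq> H"
    and "gen_cong H S = {(a, b) \<in> gen_cong V R. set_mset a \<subseteq> H}"
proof -
  \<comment> \<open>Invariance and membership are proved together: the cases \<open>sym\<close> and
    \<open>trans\<close> need the invariance to know that the other multiset lies over H.\<close>
  have *: "(set_mset a \<subseteq> H \<longleftrightarrow> set_mset b \<subseteq> H) \<and> (set_mset a \<subseteq> H \<longrightarrow> (a, b) \<in> gen_cong H S)"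
    if "(a, b) \<in> gen_cong V R" for a b
    using that
  proof (induction rule: gen_cong.induct)
    case (base a b)
    then show ?case
      using invariant retain gen_cong.base[of a b S H] by blast
  next
    case (add a b c d)
    then show ?case
      using gen_cong.add[of a b H S c d] by auto
  qed (blast intro: gen_cong.refl gen_cong.sym gen_cong.trans)+
  show "(a, b) \<in> gen_cong V R \<Longrightarrow> set_mset a \<subseteq> H \<longleftrightarrow> set_mset b \<subseteq> H"
    using * by blast
  have "(a, b) \<in> gen_cong V R" if "(a, b) \<in> gen_cong H S" for a b
    using that
  proof (induction rule: gen_cong.induct)
    case (base a b)
    then show ?case
      using assms(1,2) by (blast intro: gen_cong.base)
  next
    case (refl a)
    then show ?case
      using assms(1) by (blast intro: gen_cong.refl)
  qed (blast intro: gen_cong.sym gen_cong.trans gen_cong.add)+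
  then show "gen_cong H S = {(a, b) \<in> gen_cong V R. set_mset a \<subseteq> H}"
    using * gen_cong_subset(1)[of _ _ H S] by blast
qed

text \<open>Read as rewrite rules from left to right, the pairs in R strictly decrease the weight,
  so rewriting ends in a multiset that contains no left side.\<close>

lemma gen_cong_irreducible:
  fixes w :: "'v \<Rightarrow> nat"
  assumes R: "\<And>l r. (l, r) \<in> R \<Longrightarrow> set_mset l \<subseteq> V \<and> set_mset r \<subseteq> V
      \<and> (\<Sum>v\<in>#r. w v) < (\<Sum>v\<in>#l. w v)"
    and "set_mset a \<subseteq> V"
  obtains b where "(a, b) \<in> gen_cong V R" "\<And>l r. (l, r) \<in> R \<Longrightarrow> \<not> l \<subseteq># b"
proof -
  have "\<exists>b. (a, b) \<in> gen_cong V R \<and> (\<forall>(l, r) \<in> R. \<not> l \<subseteq># b)"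
    using assms(2)
  proof (induction "\<Sum>v\<in>#a. w v" arbitrary: a rule: less_induct)
    case less
    show ?case
    proof (cases "\<exists>(l, r) \<in> R. l \<subseteq># a")
      case True
      then obtain l r c where lr: "(l, r) \<in> R" "a = l + c"
        by (auto simp: mset_subset_eq_exists_conv)
      have c: "set_mset c \<subseteq> V"
        using less.prems lr(2) by auto
      have "(\<Sum>v\<in>#r + c. w v) < (\<Sum>v\<in>#a. w v)" "set_mset (r + c) \<subseteq> V"
        using R[OF lr(1)] lr(2) c by auto
      then obtain b where b: "(r + c, b) \<in> gen_cong V R" "\<forall>(l, r) \<in> R. \<not> l \<subseteq># b"
        using less.hyps[of "r + c"] by blast
      moreover have "(a, r + c) \<in> gen_cong V R"
        unfolding lr(2) using R[OF lr(1)] lr(1) c by (blast intro: gen_cong.intros)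
      ultimately show ?thesis
        by (blast intro: gen_cong.trans)
    next
      case False
      with less.prems show ?thesis
        by (blast intro: gen_cong.refl)
    qed
  qed
  then show thesis
    using that by blast
qed

lemma finite_bounded_msets:
  assumes "finite V"
  shows "finite {b. set_mset b \<subseteq> V \<and> (\<forall>v\<in>V. count b v \<le> n)}"
proof (rule finite_subset)
  show "finite (count -` {f. \<forall>v. (v \<in> V \<longrightarrow> f v \<in> {..n}) \<and> (v \<notin> V \<longrightarrow> f v = 0)})"
    using assms by (intro finite_vimageI finite_set_of_finite_funs) (auto simp: inj_def multiset_eq_iff)
  show "{b. set_mset b \<subseteq> V \<and> (\<forall>v\<in>V. count b v \<le> n)}
      \<subseteq> count -` {f. \<forall>v. (v \<in> V \<longrightarrow> f v \<in> {..n}) \<and> (v \<notin> V \<longrightarrow> f v = 0)}"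
    by (auto simp: count_eq_zero_iff)
qed

section \<open>The sandpile monoid\<close>

lemma carrier_SP: "carrier (SP F) = SP_class F ` {a. set_mset a \<subseteq> verts F}"
  unfolding SP_def SP_class_def carrier_presented_monoid ..

lemma comm_monoid_SP: "comm_monoid (SP F)"
  unfolding SP_def by (rule comm_monoid_presented_monoid)

lemma SP_class_closed: "set_mset a \<subseteq> verts F \<Longrightarrow> SP_class F a \<in> carrier (SP F)"
  by (simp add: carrier_SP)

lemma SP_class_mult:
  "set_mset a \<subseteq> verts F \<Longrightarrow> set_mset b \<subseteq> verts F
     \<Longrightarrow> SP_class F a \<otimes>\<^bsub>SP F\<^esub> SP_class F b = SP_class F (a + b)"
  unfolding SP_def SP_class_def by (rule mult_presented_monoid)

lemma one_SP: "\<one>\<^bsub>SP F\<^esub> = SP_class F {#}"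
  unfolding SP_def SP_class_def by (rule one_presented_monoid)

lemma SP_class_eq_iff:
  "set_mset a \<subseteq> verts F \<Longrightarrow> set_mset b \<subseteq> verts F
     \<Longrightarrow> SP_class F a = SP_class F b \<longleftrightarrow> (a, b) \<in> gen_cong (verts F) (sandpile_relations F)"
  unfolding SP_class_def by (rule eq_equiv_class_iff[OF equiv_gen_cong]) auto

lemma SP_map_SP_class:
  "set_mset a \<subseteq> verts F \<Longrightarrow> SP_map F (SP_class F a) = SP_class F a"
  unfolding SP_map_def SP_class_def
  by (rule equiv_Image_subset_class[OF equiv_gen_cong]) (auto intro: gen_cong.refl)

text \<open>A sum lies in an order-ideal iff all its summands do, so membership depends on the
  support of the multiset alone. This lets order-ideals be traded for sets of vertices.\<close>

lemma SP_class_in_order_ideal_iff: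
  assumes "order_ideal I (SP F)" "set_mset a \<subseteq> verts F"
  shows "SP_class F a \<in> I \<longleftrightarrow> (\<forall>v\<in>#a. SP_class F {#v#} \<in> I)"
  using assms(2)
proof (induction a)
  case empty
  then show ?case
    using order_idealD(2)[OF assms(1)] by (simp add: one_SP)
next
  case (add v a)
  have "SP_class F (add_mset v a) = SP_class F {#v#} \<otimes>\<^bsub>SP F\<^esub> SP_class F a"
    using add.prems by (simp add: SP_class_mult)
  with add show ?case
    using order_idealD(4)[OF assms(1), of "SP_class F {#v#}" "SP_class F a"]
    by (simp add: SP_class_closed)
qed

context sandpile_graph
begin

lemma finite_out_arcs: "finite (out_arcs E v)"
  using finite_arcs by (rule rev_finite_subset) (auto simp: out_arcs_def)

definition sink :: 'v where
  "sink = (THE v. is_sink E v)"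

lemma is_sink_sink: "is_sink E sink"
  unfolding sink_def by (rule theI'[OF unique_sink])

lemma sink_unique: "is_sink E v \<Longrightarrow> v = sink"
  using unique_sink is_sink_sink by blast

lemma reachable_sink: "v \<in> verts E \<Longrightarrow> v \<rightarrow>\<^sup>* sink"
  using connects_to_sink is_sink_sink by blast

section \<open>Hereditary saturated sets of a sandpile graph\<close>

lemma hereditary_reachable:
  assumes "hereditary E H" "v \<rightarrow>\<^sup>* w" "v \<in> H"
  shows "w \<in> H"
  using assms(2,3)
proof (induction rule: reachable_induct)
  case (step x y)
  then obtain e where "e \<in> arcs E" "tail E e = x" "head E e = y"
    by auto
  with step assms(1) show ?case
    by (auto simp: hereditary_def)
qed

text \<open>Heredity carries a vertex of H along its path to the sink. Every other vertex is regular
  because the graph is finite, so heredity and saturation combine into one equivalence; at the sink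
  both of its sides are true.\<close>

lemma hs_setsD:
  assumes "H \<in> hs_sets E"
  shows "H \<subseteq> verts E" "sink \<in> H"
    and "v \<in> verts E \<Longrightarrow> v \<in> H \<longleftrightarrow> head E ` out_arcs E v \<subseteq> H"
proof -
  have H: "H \<noteq> {}" "hereditary E H" "saturated E H" "H \<subseteq> verts E"
    using assms by (auto simp: hs_sets_def hereditary_def)
  show "H \<subseteq> verts E" by fact
  show sink: "sink \<in> H"
    using H hereditary_reachable reachable_sink by blast
  show "v \<in> H \<longleftrightarrow> head E ` out_arcs E v \<subseteq> H" if "v \<in> verts E"
  proof (cases "is_sink E v")
    case True
    then show ?thesis
      using sink sink_unique[OF True] by (simp add: is_sink_def)
  next
    case False
    then show ?thesis
      using H that finite_out_arcs by (auto simp: hereditary_def saturated_def regular_def)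
  qed
qed

lemma hs_setsI:
  assumes "H \<subseteq> verts E" "sink \<in> H"
    and "\<And>v. v \<in> verts E \<Longrightarrow> v \<noteq> sink \<Longrightarrow> v \<in> H \<longleftrightarrow> head E ` out_arcs E v \<subseteq> H"
  shows "H \<in> hs_sets E"
proof -
  have "head E e \<in> H" if "e \<in> arcs E" "tail E e \<in> H" for e
  proof -
    have e: "e \<in> out_arcs E (tail E e)"
      using that by simp
    then have "tail E e \<noteq> sink"
      using is_sink_sink by (auto simp: is_sink_def)
    with e show ?thesis
      using assms(3)[of "tail E e"] that by auto
  qed
  moreover have "v \<in> H" if "regular E v" "head E ` out_arcs E v \<subseteq> H" for v
    using that assms(3)[of v] is_sink_sink by (auto simp: regular_def)
  ultimately show ?thesis
    using assms(1,2) by (auto simp: hs_sets_def hereditary_def saturated_def)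
qed

lemma verts_hs: "verts E \<in> hs_sets E"
  using is_sink_sink by (intro hs_setsI) (auto simp: is_sink_def)

lemma Int_hs: "H \<in> hs_sets E \<Longrightarrow> K \<in> hs_sets E \<Longrightarrow> H \<inter> K \<in> hs_sets E"
  by (rule hs_setsI) (auto dest: hs_setsD)

section \<open>Restriction graphs and their defining relations\<close>

lemma is_sink_restriction:
  "H \<in> hs_sets E \<Longrightarrow> is_sink (restriction E H) v \<longleftrightarrow> v \<in> H \<and> is_sink E v"
  using hs_setsD(1)[of H] by (auto simp: is_sink_def restriction_def out_arcs_def)

lemma out_arcs_restriction: "v \<in> H \<Longrightarrow> out_arcs (restriction E H) v = out_arcs E v"
  by (auto simp: restriction_def out_arcs_def)

lemma restriction_simps [simp]: "verts (restriction E H) = H" "head (restriction E H) = head E"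
  by (simp_all add: restriction_def)

lemma restriction_verts: "restriction E (verts E) = E"
proof -
  have "{e \<in> arcs E. tail E e \<in> verts E} = arcs E"
    by auto
  then show ?thesis
    by (simp add: restriction_def)
qed

text \<open>The case \<open>topple\<close> records a nonzero out-degree, because it makes the
  support of the left side exactly {v}.\<close>

lemma sandpile_relations_cases:
  assumes "(a, b) \<in> sandpile_relations E"
  obtains (sink) v where "v = sink" "v \<in> verts E" "a = {#v#}" "b = {#}"
  | (topple) v where "v \<in> verts E" "\<not> is_sink E v" "card (out_arcs E v) \<noteq> 0"
      "a = replicate_mset (card (out_arcs E v)) v" "b = image_mset (head E) (mset_set (out_arcs E v))"
  using assms sink_unique finite_out_arcs
  by (auto simp: sandpile_relations_def is_sink_def)

lemma sandpile_relations_invariant: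
  assumes "H \<in> hs_sets E" "(a, b) \<in> sandpile_relations E"
  shows "set_mset a \<subseteq> H \<longleftrightarrow> set_mset b \<subseteq> H"
  using assms(2)
proof (cases rule: sandpile_relations_cases)
  case (topple v)
  then show ?thesis
    using hs_setsD(3)[OF assms(1), of v] finite_out_arcs by simp
qed (use hs_setsD(2)[OF assms(1)] in simp)

lemma sandpile_relations_restriction:
  assumes "H \<in> hs_sets E"
  shows "sandpile_relations (restriction E H) \<subseteq> sandpile_relations E"
    and "(a, b) \<in> sandpile_relations E \<Longrightarrow> set_mset a \<subseteq> H
      \<Longrightarrow> (a, b) \<in> sandpile_relations (restriction E H)"
proof -
  show "sandpile_relations (restriction E H) \<subseteq> sandpile_relations E"
    using hs_setsD(1)[OF assms]
    unfolding sandpile_relations_def is_sink_restriction[OF assms] restriction_simps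
    by (force simp: out_arcs_restriction)
  assume "(a, b) \<in> sandpile_relations E" "set_mset a \<subseteq> H"
  then show "(a, b) \<in> sandpile_relations (restriction E H)"
  proof (cases rule: sandpile_relations_cases)
    case (sink v)
    then show ?thesis
      using \<open>set_mset a \<subseteq> H\<close> is_sink_sink
      by (auto simp: sandpile_relations_def is_sink_restriction[OF assms])
  next
    case (topple v)
    then have "v \<in> H"
      using \<open>set_mset a \<subseteq> H\<close> by simp
    with topple show ?thesis
      unfolding sandpile_relations_def is_sink_restriction[OF assms] restriction_simps
      by (auto simp: out_arcs_restriction intro!: exI[of _ v])
  qed
qed

section \<open>Support invariance and the natural maps\<close>

lemma support_invariant:
  assumes "H \<in> hs_sets E" "(a, b) \<in> gen_cong (verts E) (sandpile_relations E)"
  shows "set_mset a \<subseteq> H \<longleftrightarrow> set_mset b \<subseteq> H"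
  by (rule gen_cong_restrict(1)[OF hs_setsD(1)[OF assms(1)]
        sandpile_relations_restriction(1)[OF assms(1)] sandpile_relations_invariant[OF assms(1)]
        sandpile_relations_restriction(2)[OF assms(1)] assms(2)])

text \<open>By \<open>support_invariant\<close> a congruence class of \<^term>\<open>E\<close> that meets the multisets over \<^term>\<open>H\<close>
  consists of such multisets only, so the natural map from the monoid of the restriction is the
  identity on classes.\<close>

lemma SP_class_restriction:
  assumes "H \<in> hs_sets E" "set_mset a \<subseteq> H"
  shows "SP_class (restriction E H) a = SP_class E a"
  using assms(2) gen_cong_restrict(2)[OF hs_setsD(1)[OF assms(1)]
      sandpile_relations_restriction(1)[OF assms(1)] sandpile_relations_invariant[OF assms(1)]
      sandpile_relations_restriction(2)[OF assms(1)]]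
  unfolding SP_class_def by auto

lemma carrier_SP_restriction:
  assumes "H \<in> hs_sets E"
  shows "carrier (SP (restriction E H)) = SP_class E ` {a. set_mset a \<subseteq> H}"
  using SP_class_restriction[OF assms] by (simp add: carrier_SP)

lemma carrier_SP_restriction_mono:
  "H \<in> hs_sets E \<Longrightarrow> K \<in> hs_sets E \<Longrightarrow> H \<subseteq> K
     \<Longrightarrow> carrier (SP (restriction E H)) \<subseteq> carrier (SP (restriction E K))"
  by (auto simp: carrier_SP_restriction)

lemma mult_SP_restriction:
  assumes "H \<in> hs_sets E" "X \<in> carrier (SP (restriction E H))" "Y \<in> carrier (SP (restriction E H))"
  shows "X \<otimes>\<^bsub>SP (restriction E H)\<^esub> Y = X \<otimes>\<^bsub>SP E\<^esub> Y"
proof -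
  obtain a b where ab: "set_mset a \<subseteq> H" "set_mset b \<subseteq> H" "X = SP_class E a" "Y = SP_class E b"
    using assms by (auto simp: carrier_SP_restriction)
  then show ?thesis
    using SP_class_mult[of a "restriction E H" b] SP_class_mult[of a E b] hs_setsD(1)[OF assms(1)]
    by (simp add: SP_class_restriction[OF assms(1)])
qed

lemma one_SP_restriction: "H \<in> hs_sets E \<Longrightarrow> \<one>\<^bsub>SP (restriction E H)\<^esub> = \<one>\<^bsub>SP E\<^esub>"
  by (simp add: one_SP SP_class_restriction)

lemma SP_map_restriction:
  assumes "H \<in> hs_sets E" "K \<in> hs_sets E" "H \<subseteq> K" "X \<in> carrier (SP (restriction E H))"
  shows "SP_map (restriction E K) X = X"
proof -
  obtain a where a: "set_mset a \<subseteq> H" "X = SP_class E a"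
    using assms by (auto simp: carrier_SP_restriction)
  then show ?thesis
    using SP_map_SP_class[of a "restriction E K"] SP_class_restriction[OF assms(2), of a] assms(3)
    by simp
qed

lemma SP_map_E: "H \<in> hs_sets E \<Longrightarrow> X \<in> carrier (SP (restriction E H)) \<Longrightarrow> SP_map E X = X"
  using SP_map_restriction[OF _ verts_hs] hs_setsD(1) by (simp add: restriction_verts)

lemma SP_map_image:
  "H \<in> hs_sets E \<Longrightarrow> A \<subseteq> carrier (SP (restriction E H)) \<Longrightarrow> SP_map E ` A = A"
  using SP_map_E[of H] by (auto simp: subset_iff image_iff)

lemma SP_map_hom:
  assumes "H \<in> hs_sets E" "K \<in> hs_sets E" "H \<subseteq> K"
  shows "SP_map (restriction E K) \<in> hom (SP (restriction E H)) (SP (restriction E K))"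
proof (rule homI)
  fix X Y
  assume XY: "X \<in> carrier (SP (restriction E H))" "Y \<in> carrier (SP (restriction E H))"
  interpret H: comm_monoid "SP (restriction E H)"
    by (rule comm_monoid_SP)
  have XY': "X \<in> carrier (SP (restriction E K))" "Y \<in> carrier (SP (restriction E K))"
    using XY carrier_SP_restriction_mono[OF assms] by auto
  show "SP_map (restriction E K) X \<in> carrier (SP (restriction E K))"
    using XY(1) XY'(1) by (simp add: SP_map_restriction[OF assms])
  show "SP_map (restriction E K) (X \<otimes>\<^bsub>SP (restriction E H)\<^esub> Y)
      = SP_map (restriction E K) X \<otimes>\<^bsub>SP (restriction E K)\<^esub> SP_map (restriction E K) Y"
    using XY XY' H.m_closed[OF XY] mult_SP_restriction[OF assms(1) XY] mult_SP_restriction[OF assms(2) XY']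
    by (simp add: SP_map_restriction[OF assms])
qed

lemma submonoid_SP_map:
  assumes "H \<in> hs_sets E" "K \<in> hs_sets E" "H \<subseteq> K"
  shows "submonoid (SP_map (restriction E K) ` carrier (SP (restriction E H))) (SP (restriction E K))"
proof -
  interpret H: comm_monoid "SP (restriction E H)"
    by (rule comm_monoid_SP)
  note mono = carrier_SP_restriction_mono[OF assms]
  have image: "SP_map (restriction E K) ` carrier (SP (restriction E H)) = carrier (SP (restriction E H))"
    using SP_map_restriction[OF assms] by force
  show ?thesis
    unfolding image
  proof
    fix X Y
    assume XY: "X \<in> carrier (SP (restriction E H))" "Y \<in> carrier (SP (restriction E H))"
    then have "X \<otimes>\<^bsub>SP (restriction E K)\<^esub> Y = X \<otimes>\<^bsub>SP (restriction E H)\<^esub> Y"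
      using mult_SP_restriction[OF assms(1) XY] mult_SP_restriction[OF assms(2)] mono by auto
    then show "X \<otimes>\<^bsub>SP (restriction E K)\<^esub> Y \<in> carrier (SP (restriction E H))"
      using H.m_closed[OF XY] by simp
  next
    show "\<one>\<^bsub>SP (restriction E K)\<^esub> \<in> carrier (SP (restriction E H))"
      using H.one_closed by (simp add: one_SP_restriction assms(1,2))
  qed (rule mono)
qed

section \<open>Order-ideals versus hereditary saturated sets\<close>

lemma SP_class_in_restriction_iff:
  assumes "H \<in> hs_sets E" "set_mset a \<subseteq> verts E"
  shows "SP_class E a \<in> carrier (SP (restriction E H)) \<longleftrightarrow> set_mset a \<subseteq> H"
proof
  assume "SP_class E a \<in> carrier (SP (restriction E H))"
  then obtain b where "set_mset b \<subseteq> H" "SP_class E a = SP_class E b"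
    by (auto simp: carrier_SP_restriction[OF assms(1)])
  then show "set_mset a \<subseteq> H"
    using SP_class_eq_iff[OF assms(2), of b] support_invariant[OF assms(1)] hs_setsD(1)[OF assms(1)]
    by blast
qed (auto simp: carrier_SP_restriction[OF assms(1)])

lemma order_ideal_SP_restriction:
  assumes "H \<in> hs_sets E"
  shows "order_ideal (carrier (SP (restriction E H))) (SP E)"
proof -
  interpret comm_monoid "SP E"
    by (rule comm_monoid_SP)
  show ?thesis
  proof (rule order_idealI)
    show "carrier (SP (restriction E H)) \<subseteq> carrier (SP E)"
      using hs_setsD(1)[OF assms] by (auto simp: carrier_SP_restriction[OF assms] carrier_SP[of E])
    show "\<one>\<^bsub>SP E\<^esub> \<in> carrier (SP (restriction E H))"
      using assms by (simp add: one_SP carrier_SP_restriction)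
    fix X Y
    assume "X \<in> carrier (SP E)" "Y \<in> carrier (SP E)"
    then show "X \<otimes>\<^bsub>SP E\<^esub> Y \<in> carrier (SP (restriction E H)) \<longleftrightarrow>
        X \<in> carrier (SP (restriction E H)) \<and> Y \<in> carrier (SP (restriction E H))"
      by (auto simp: carrier_SP[of E] SP_class_mult SP_class_in_restriction_iff[OF assms])
  qed
qed

text \<open>One inclusion is minimality of the generated ideal; for the other, a class supported in
  H is a sum of classes of vertices of H.\<close>

lemma SP_restriction_eq_order_ideal_gen:
  assumes "H \<in> hs_sets E"
  shows "carrier (SP (restriction E H)) = order_ideal_gen (SP E) ((\<lambda>v. SP_class E {#v#}) ` H)"
    (is "?I = order_ideal_gen _ ?X")
proof
  interpret comm_monoid "SP E"
    by (rule comm_monoid_SP)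
  have XI: "?X \<subseteq> ?I"
    by (auto simp: carrier_SP_restriction[OF assms])
  then show "order_ideal_gen (SP E) ?X \<subseteq> ?I"
    by (rule order_ideal_gen_subset[OF order_ideal_SP_restriction[OF assms]])
  have X: "?X \<subseteq> carrier (SP E)" "?X \<noteq> {}"
    using XI order_idealD(1)[OF order_ideal_SP_restriction[OF assms]] hs_setsD(2)[OF assms] by blast+
  note J = order_ideal_order_ideal_gen[OF X]
  show "?I \<subseteq> order_ideal_gen (SP E) ?X"
  proof
    fix Y
    assume "Y \<in> ?I"
    then obtain a where "set_mset a \<subseteq> H" "Y = SP_class E a"
      by (auto simp: carrier_SP_restriction[OF assms])
    then show "Y \<in> order_ideal_gen (SP E) ?X"
      using SP_class_in_order_ideal_iff[OF J(1), of a] J(2) hs_setsD(1)[OF assms] by blast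
  qed
qed

text \<open>Inverse of the passage from H to the carrier of SP(E_H), as
  \<open>order_ideal_eq\<close> and \<open>SP_restriction_subset_iff\<close> show together.\<close>

definition ideal_verts :: "'v multiset set set \<Rightarrow> 'v set" where
  "ideal_verts I = {v \<in> verts E. SP_class E {#v#} \<in> I}"

lemma SP_class_relation:
  "(a, b) \<in> sandpile_relations E \<Longrightarrow> set_mset a \<subseteq> verts E \<Longrightarrow> set_mset b \<subseteq> verts E
     \<Longrightarrow> SP_class E a = SP_class E b"
  by (simp add: SP_class_eq_iff gen_cong.base)

lemma ideal_verts_hs:
  assumes "order_ideal I (SP E)"
  shows "ideal_verts I \<in> hs_sets E"
proof (rule hs_setsI)
  have sink: "sink \<in> verts E"
    using is_sink_sink by (simp add: is_sink_def)
  have "SP_class E {#sink#} = \<one>\<^bsub>SP E\<^esub>"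
    unfolding one_SP using is_sink_sink sink
    by (intro SP_class_relation) (auto simp: sandpile_relations_def)
  then show "sink \<in> ideal_verts I"
    using sink order_idealD(2)[OF assms] by (simp add: ideal_verts_def)
  fix v
  assume v: "v \<in> verts E" "v \<noteq> sink"
  define a where "a = replicate_mset (card (out_arcs E v)) v"
  define b where "b = image_mset (head E) (mset_set (out_arcs E v))"
  have ns: "\<not> is_sink E v"
    using v sink_unique by blast
  \<comment> \<open>A positive out-degree ensures that v occurs in a, so that membership of the
    class of a in I says something about v.\<close>
  then have "card (out_arcs E v) \<noteq> 0"
    using v finite_out_arcs by (simp add: is_sink_def)
  then have set: "set_mset a = {v}" "set_mset b = head E ` out_arcs E v"
    using finite_out_arcs by (simp_all add: a_def b_def)
  have heads: "head E ` out_arcs E v \<subseteq> verts E"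
    by auto
  have "SP_class E a = SP_class E b"
    using v ns set heads
    by (intro SP_class_relation) (auto simp: sandpile_relations_def a_def b_def)
  then have "SP_class E {#v#} \<in> I \<longleftrightarrow> (\<forall>u \<in> head E ` out_arcs E v. SP_class E {#u#} \<in> I)"
    using SP_class_in_order_ideal_iff[OF assms, of a] SP_class_in_order_ideal_iff[OF assms, of b]
      v(1) heads unfolding set by simp
  then show "v \<in> ideal_verts I \<longleftrightarrow> head E ` out_arcs E v \<subseteq> ideal_verts I"
    using v(1) heads by (auto simp: ideal_verts_def)
qed (auto simp: ideal_verts_def)

lemma order_ideal_eq:
  assumes "order_ideal I (SP E)"
  shows "I = carrier (SP (restriction E (ideal_verts I)))"
proof -
  have "I = SP_class E ` {a. set_mset a \<subseteq> verts E \<and> SP_class E a \<in> I}"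
    using order_idealD(1)[OF assms] by (auto simp: carrier_SP)
  also have "{a. set_mset a \<subseteq> verts E \<and> SP_class E a \<in> I} = {a. set_mset a \<subseteq> ideal_verts I}"
    using SP_class_in_order_ideal_iff[OF assms] by (auto simp: ideal_verts_def)
  finally show ?thesis
    using carrier_SP_restriction[OF ideal_verts_hs[OF assms]] by simp
qed

text \<open>The class of a single vertex v lies in SP(E_K) exactly when v lies in K, so the carriers
  recover the vertex sets.\<close>

lemma SP_restriction_subset_iff:
  assumes "H \<in> hs_sets E" "K \<in> hs_sets E"
  shows "carrier (SP (restriction E H)) \<subseteq> carrier (SP (restriction E K)) \<longleftrightarrow> H \<subseteq> K"
proof
  assume sub: "carrier (SP (restriction E H)) \<subseteq> carrier (SP (restriction E K))"
  show "H \<subseteq> K"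
  proof
    fix v
    assume v: "v \<in> H"
    then have "SP_class E {#v#} \<in> carrier (SP (restriction E H))" "v \<in> verts E"
      using hs_setsD(1)[OF assms(1)] by (auto simp: SP_class_in_restriction_iff[OF assms(1)])
    with sub show "v \<in> K"
      using SP_class_in_restriction_iff[OF assms(2), of "{#v#}"] by auto
  qed
qed (rule carrier_SP_restriction_mono[OF assms])

lemma bij_betw_order_ideals:
  "bij_betw (\<lambda>H. carrier (SP (restriction E H))) (hs_sets E) {I. order_ideal I (SP E)}"
  unfolding bij_betw_def
proof
  show "inj_on (\<lambda>H. carrier (SP (restriction E H))) (hs_sets E)"
    by (rule inj_onI) (metis SP_restriction_subset_iff subset_refl subset_antisym)
  show "(\<lambda>H. carrier (SP (restriction E H))) ` hs_sets E = {I. order_ideal I (SP E)}"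
    using order_ideal_SP_restriction order_ideal_eq ideal_verts_hs by blast
qed

section \<open>The lattice of hereditary saturated sets\<close>

lemma hs_closure_hs:
  assumes "H \<in> hs_sets E" "K \<in> hs_sets E"
  shows "hs_closure E (H \<union> K) \<in> hs_sets E" "H \<union> K \<subseteq> hs_closure E (H \<union> K)"
    and "D \<in> hs_sets E \<Longrightarrow> H \<union> K \<subseteq> D \<Longrightarrow> hs_closure E (H \<union> K) \<subseteq> D"
proof -
  define F where "F = {D. (hereditary E D \<and> saturated E D) \<and> H \<union> K \<subseteq> D}"
  have closure: "hs_closure E (H \<union> K) = \<Inter>F"
    by (simp add: hs_closure_def hull_def F_def)
  \<comment> \<open>The hull ranges over all hereditary saturated sets; those above H contain the
    sink and are therefore nonempty.\<close>
  have F: "D \<in> F \<longleftrightarrow> D \<in> hs_sets E \<and> H \<union> K \<subseteq> D" for D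
    using hs_setsD(2)[OF assms(1)] by (auto simp: F_def hs_sets_def)
  then show "H \<union> K \<subseteq> hs_closure E (H \<union> K)"
    and "D \<in> hs_sets E \<Longrightarrow> H \<union> K \<subseteq> D \<Longrightarrow> hs_closure E (H \<union> K) \<subseteq> D"
    by (auto simp: closure)
  \<comment> \<open>This member keeps the intersection inside the vertex set; an empty family would
    give the universal set.\<close>
  have "verts E \<in> F"
    using F verts_hs hs_setsD(1)[OF assms(1)] hs_setsD(1)[OF assms(2)] by blast
  then show "hs_closure E (H \<union> K) \<in> hs_sets E"
    unfolding closure
  proof (intro hs_setsI)
    show "sink \<in> \<Inter>F"
      using F hs_setsD(2) by blast
    fix v
    assume "v \<in> verts E"
    then show "v \<in> \<Inter>F \<longleftrightarrow> head E ` out_arcs E v \<subseteq> \<Inter>F"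
      using F hs_setsD(3) by blast
  qed auto
qed

lemma lattice_hs_sets: "lattice (inclusion_order (hs_sets E))"
proof (rule lattice_inclusionI)
  fix H K
  assume HK: "H \<in> hs_sets E" "K \<in> hs_sets E"
  show "\<exists>C\<in>hs_sets E. H \<union> K \<subseteq> C \<and> (\<forall>D\<in>hs_sets E. H \<union> K \<subseteq> D \<longrightarrow> C \<subseteq> D)"
    using hs_closure_hs[OF HK] by (intro bexI[of _ "hs_closure E (H \<union> K)"]) simp_all
  show "\<exists>C\<in>hs_sets E. C \<subseteq> H \<inter> K \<and> (\<forall>D\<in>hs_sets E. D \<subseteq> H \<inter> K \<longrightarrow> D \<subseteq> C)"
    using Int_hs[OF HK] by (intro bexI[of _ "H \<inter> K"]) simp_all
qed

lemma join_hs_sets: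
  "H \<in> hs_sets E \<Longrightarrow> K \<in> hs_sets E \<Longrightarrow> H \<squnion>\<^bsub>inclusion_order (hs_sets E)\<^esub> K = hs_closure E (H \<union> K)"
  by (intro inclusion_join(2) hs_closure_hs)

lemma meet_hs_sets:
  "H \<in> hs_sets E \<Longrightarrow> K \<in> hs_sets E \<Longrightarrow> H \<sqinter>\<^bsub>inclusion_order (hs_sets E)\<^esub> K = H \<inter> K"
  by (intro inclusion_meet(2) Int_hs) auto

subsection \<open>Finiteness\<close>

text \<open>With \<open>u v = N ^ (D - d v)\<close>, where \<open>d v\<close> is the distance from \<open>v\<close> to the sink and \<open>N\<close> exceeds all
  out-degrees, the successor of \<open>v\<close> on a shortest path to the sink alone makes
  the sum of \<open>u\<close> over the successors exceed \<open>u v\<close> times the out-degree.\<close>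

lemma toppling_weight:
  obtains w :: "'v \<Rightarrow> nat" where "\<And>v. w v > 0"
    "\<And>v. v \<in> verts E \<Longrightarrow> v \<noteq> sink
       \<Longrightarrow> (\<Sum>e\<in>out_arcs E v. w (head E e)) < card (out_arcs E v) * w v"
proof -
  define d where "d v = (LEAST k. (v, sink) \<in> arcs_ends E ^^ k)" for v
  \<comment> \<open>A common upper bound of the distances, which keeps the subtraction D - d v from
    being truncated at 0.\<close>
  define D where "D = (\<Sum>v\<in>verts E. d v)"
  define N where "N = Suc (card (arcs E))"
  define u where "u v = N ^ (D - d v)" for v
  \<comment> \<open>Toppling increases the total of u. Both sides of a toppling have equally many
    grains, so subtracting u from a constant reverses the inequality; the \<open>Suc\<close> keeps w
    positive, so that removing a grain at the sink also decreases the weight.\<close>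
  define w where "w v = Suc (N ^ D) - u v" for v
  have closer: "\<exists>e\<in>out_arcs E v. d (head E e) < d v" if v: "v \<in> verts E" "v \<noteq> sink" for v
  proof -
    have "(v, sink) \<in> (arcs_ends E)\<^sup>*"
      using reachable_sink[OF v(1)] by (rule reachable_rtranclI)
    then have dv: "(v, sink) \<in> arcs_ends E ^^ d v"
      unfolding d_def rtrancl_power by (metis LeastI)
    moreover have "d v \<noteq> 0"
      using dv v(2) by (cases "d v") auto
    ultimately obtain m y where m: "d v = Suc m" "v \<rightarrow> y" "(y, sink) \<in> arcs_ends E ^^ m"
      by (metis not0_implies_Suc relpow_Suc_D2)
    then have "d y \<le> m"
      unfolding d_def by (intro Least_le)
    moreover obtain e where "e \<in> arcs E" "tail E e = v" "head E e = y"
      using m(2) by auto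
    ultimately show ?thesis
      using m(1) by (intro bexI[of _ e]) auto
  qed
  have u_le: "u v \<le> N ^ D" for v
    unfolding u_def by (rule power_increasing) (auto simp: N_def)
  show thesis
  proof (rule that)
    show "w v > 0" for v
      using u_le[of v] by (simp add: w_def)
    fix v
    assume v: "v \<in> verts E" "v \<noteq> sink"
    then obtain e where e: "e \<in> out_arcs E v" "d (head E e) < d v"
      using closer by blast
    have "d v \<le> D"
      unfolding D_def by (rule member_le_sum) (use v in auto)
    with e(2) have "N ^ Suc (D - d v) \<le> u (head E e)"
      unfolding u_def by (intro power_increasing) (auto simp: N_def)
    moreover have "card (out_arcs E v) < N"
      unfolding N_def less_Suc_eq_le by (rule card_mono) (auto simp: out_arcs_def)
    then have "card (out_arcs E v) * u v < N * u v"
      by (rule mult_less_mono1) (simp add: u_def N_def)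
    moreover have "u (head E e) \<le> (\<Sum>e\<in>out_arcs E v. u (head E e))"
      by (rule member_le_sum) (use e finite_out_arcs in auto)
    moreover have "N ^ Suc (D - d v) = N * u v"
      by (simp add: u_def)
    ultimately have "card (out_arcs E v) * u v < (\<Sum>e\<in>out_arcs E v. u (head E e))"
      by linarith
    moreover have "w x + u x = Suc (N ^ D)" for x
      using u_le[of x] by (simp add: w_def)
    then have "(\<Sum>e\<in>out_arcs E v. w (head E e)) + (\<Sum>e\<in>out_arcs E v. u (head E e))
        = card (out_arcs E v) * w v + card (out_arcs E v) * u v"
      by (simp flip: sum.distrib distrib_left)
    ultimately show "(\<Sum>e\<in>out_arcs E v. w (head E e)) < card (out_arcs E v) * w v"
      by linarith
  qed
qed

text \<open>Irreducible configurations are the stable ones without grains at the sink: every other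
  vertex carries fewer grains than its out-degree. There are finitely many of them, and every class
  contains one.\<close>

lemma finite_carrier_SP: "finite (carrier (SP E))"
proof -
  obtain w :: "'v \<Rightarrow> nat" where w: "\<And>v. w v > 0" "\<And>v. v \<in> verts E \<Longrightarrow> v \<noteq> sink
       \<Longrightarrow> (\<Sum>e\<in>out_arcs E v. w (head E e)) < card (out_arcs E v) * w v"
    by (rule toppling_weight) blast
  have decrease: "set_mset l \<subseteq> verts E \<and> set_mset r \<subseteq> verts E \<and> (\<Sum>v\<in>#r. w v) < (\<Sum>v\<in>#l. w v)"
    if "(l, r) \<in> sandpile_relations E" for l r
    using that
  proof (cases rule: sandpile_relations_cases)
    case (sink v)
    then show ?thesis
      using w(1) by simp
  next
    case (topple v)
    have "v \<noteq> sink"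
      using topple is_sink_sink by blast
    moreover have "(\<Sum>x\<in>#l. w x) = card (out_arcs E v) * w v"
      by (simp add: topple)
    moreover have "(\<Sum>x\<in>#r. w x) = (\<Sum>e\<in>out_arcs E v. w (head E e))"
      by (simp add: topple sum_unfold_sum_mset image_mset.compositionality comp_def)
    moreover have "set_mset l \<subseteq> verts E" "set_mset r \<subseteq> verts E"
      using topple finite_out_arcs by auto
    ultimately show ?thesis
      using w(2) topple(1) by auto
  qed
  let ?B = "{b. set_mset b \<subseteq> verts E \<and> (\<forall>v\<in>verts E. count b v \<le> card (arcs E))}"
  have "carrier (SP E) \<subseteq> SP_class E ` ?B"
  proof
    fix X
    assume "X \<in> carrier (SP E)"
    then obtain a where a: "set_mset a \<subseteq> verts E" "X = SP_class E a"
      by (auto simp: carrier_SP)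
    obtain b where b: "(a, b) \<in> gen_cong (verts E) (sandpile_relations E)"
      "\<And>l r. (l, r) \<in> sandpile_relations E \<Longrightarrow> \<not> l \<subseteq># b"
      by (rule gen_cong_irreducible[OF decrease a(1)]) blast+
    have "set_mset b \<subseteq> verts E"
      using gen_cong_subset(2)[OF b(1)] .
    moreover have "count b v \<le> card (arcs E)" if v: "v \<in> verts E" for v
    proof (cases "is_sink E v")
      case True
      then have "\<not> {#v#} \<subseteq># b"
        by (intro b(2)[of _ "{#}"]) (auto simp: sandpile_relations_def)
      then show ?thesis
        by (simp add: not_in_iff)
    next
      case False
      with v have "\<not> replicate_mset (card (out_arcs E v)) v \<subseteq># b"
        by (intro b(2)[of _ "image_mset (head E) (mset_set (out_arcs E v))"])
          (auto simp: sandpile_relations_def)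
      then have "count b v < card (out_arcs E v)"
        by (simp flip: count_le_replicate_mset_subset_eq)
      also have "\<dots> \<le> card (arcs E)"
        by (rule card_mono) (auto simp: out_arcs_def)
      finally show ?thesis
        by simp
    qed
    moreover have "X = SP_class E b"
      using a b(1) SP_class_eq_iff gen_cong_subset(2) by blast
    ultimately show "X \<in> SP_class E ` ?B"
      by blast
  qed
  moreover have "finite (SP_class E ` ?B)"
    by (intro finite_imageI finite_bounded_msets finite_verts)
  ultimately show ?thesis
    by (rule finite_subset)
qed

lemma finite_comm_monoid_SP_restriction:
  assumes "H \<in> hs_sets E"
  shows "finite_comm_monoid (SP (restriction E H))"
  using comm_monoid_SP[of "restriction E H"] finite_carrier_SP
    order_idealD(1)[OF order_ideal_SP_restriction[OF assms]] finite_subset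
  unfolding finite_comm_monoid_def finite_comm_monoid_axioms_def by blast

subsection \<open>Units\<close>

text \<open>A repeated vertex cuts out a shorter closed walk, whose arcs are still among those of p;
  a closed walk without repetition is a cycle.\<close>

lemma closed_walk_contains_cycle:
  assumes "awalk u p u" "p \<noteq> []"
  obtains q where "cycle q" "set q \<subseteq> set p"
proof -
  have "\<exists>q. cycle q \<and> set q \<subseteq> set p"
    using assms
  proof (induction "length p" arbitrary: p u rule: less_induct)
    case less
    show ?case
    proof (cases "distinct (tl (awalk_verts u p))")
      case True
      with less.prems show ?thesis
        unfolding cycle_def by blast
    next
      case False
      obtain e es where p: "p = e # es"
        using less.prems(2) by (cases p) auto
      \<comment> \<open>\<open>cycle\<close> compares all vertices but the first, which recurs as
        the last; what remains is the vertex list of the walk es from the head of e.\<close>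
      then have "awalk (head E e) es u" "\<not> distinct (awalk_verts (head E e) es)"
        using less.prems(1) False by (auto simp: awalk_Cons_iff)
      then obtain q r s x where "es = q @ r @ s" "r \<noteq> []" "awalk x r x"
        using awalk_not_distinct_decomp[of "head E e" es u] by auto
      then have "\<exists>q. cycle q \<and> set q \<subseteq> set r" "set r \<subseteq> set p"
        using less.hyps[of r x] p by auto
      then show ?thesis
        by blast
    qed
  qed
  then show thesis
    using that by blast
qed

text \<open>Negated, this is the equivalence that \<open>hs_setsI\<close> demands. The required
  successor is the next vertex on a walk to the cycle, or the next one on the cycle itself if v
  already lies there.\<close>

lemma connects_to_cycle_step:
  assumes "v \<in> verts E"
  shows "connects_to_cycle E v \<longleftrightarrow> (\<exists>e\<in>out_arcs E v. connects_to_cycle E (head E e))"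
proof
  assume "connects_to_cycle E v"
  then obtain p e where pe: "cycle p" "e \<in> set p" "v \<rightarrow>\<^sup>* tail E e"
    unfolding connects_to_cycle_def by blast
  from pe(3) show "\<exists>e\<in>out_arcs E v. connects_to_cycle E (head E e)"
  proof (cases rule: converse_reachable_cases)
    case base
    \<comment> \<open>Here v is the tail of e: from the head of e the cycle continues along p2 to
      its base point u, and then along p1 back to v.\<close>
    obtain u where "awalk u p u"
      using pe(1) unfolding cycle_def by blast
    moreover obtain p1 p2 where "p = p1 @ e # p2"
      using pe(2) by (meson split_list)
    ultimately have "awalk u p1 (tail E e)" "awalk (head E e) p2 u" "e \<in> arcs E"
      by (auto simp: awalk_append_iff awalk_Cons_iff)
    then have "head E e \<rightarrow>\<^sup>* tail E e" "e \<in> out_arcs E v"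
      using base by (auto intro: reachable_trans reachable_awalkI)
    then show ?thesis
      using pe unfolding connects_to_cycle_def by blast
  next
    case (step w)
    then obtain f where "f \<in> out_arcs E v" "head E f = w"
      by auto
    then show ?thesis
      using step pe unfolding connects_to_cycle_def by blast
  qed
next
  assume "\<exists>e\<in>out_arcs E v. connects_to_cycle E (head E e)"
  then obtain e p f where e: "e \<in> out_arcs E v" and p: "cycle p" "f \<in> set p" "head E e \<rightarrow>\<^sup>* tail E f"
    unfolding connects_to_cycle_def by blast
  have "v \<rightarrow> head E e"
    using e by (auto intro: in_arcs_imp_in_arcs_ends)
  then have "v \<rightarrow>\<^sup>* tail E f"
    using p(3) by (rule adj_reachable_trans)
  with p show "connects_to_cycle E v"
    unfolding connects_to_cycle_def by blast
qed

lemma no_cycle_verts_hs: "no_cycle_verts E \<in> hs_sets E"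
proof (rule hs_setsI)
  show "sink \<in> no_cycle_verts E"
    using connects_to_cycle_step[of sink] is_sink_sink by (auto simp: no_cycle_verts_def is_sink_def)
  show "v \<in> no_cycle_verts E \<longleftrightarrow> head E ` out_arcs E v \<subseteq> no_cycle_verts E" if "v \<in> verts E" for v
    using connects_to_cycle_step[OF that] that by (auto simp: no_cycle_verts_def)
qed (auto simp: no_cycle_verts_def)

text \<open>The infinite walk is replaced by well-founded induction: R is finite, and a closed chain
  in R would contain a cycle reachable from one of the vertices that connect to none.\<close>

lemma no_cycle_verts_subset_hs:
  assumes "H \<in> hs_sets E"
  shows "no_cycle_verts E \<subseteq> H"
proof -
  \<comment> \<open>Arcs are reversed so that successors come before v in the induction.\<close>
  define R where "R = {(y, x). x \<in> no_cycle_verts E \<and> x \<rightarrow> y}"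
  have "R \<subseteq> verts E \<times> verts E"
    by (auto simp: R_def no_cycle_verts_def)
  then have "finite R"
    by (rule finite_subset) simp
  moreover have "acyclic R"
  proof (rule acyclicI, rule allI, rule notI)
    fix x
    assume x: "(x, x) \<in> R\<^sup>+"
    then have "x \<in> no_cycle_verts E"
      by (auto simp: R_def dest: tranclD2)
    have "R\<^sup>+ \<subseteq> ((arcs_ends E)\<inverse>)\<^sup>+"
      by (rule trancl_mono_subset) (auto simp: R_def)
    then have "x \<rightarrow>\<^sup>+ x"
      using x by (auto simp: trancl_converse)
    then obtain p where p: "awalk x p x" "p \<noteq> []"
      by (auto simp: reachable1_awalk)
    then obtain q where q: "cycle q" "set q \<subseteq> set p"
      by (rule closed_walk_contains_cycle)
    obtain e where e: "e \<in> set q"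
      using q(1) unfolding cycle_def by (cases q) auto
    obtain p1 p2 where "p = p1 @ e # p2"
      using e q(2) by (meson split_list subsetD)
    with p(1) have "awalk x p1 (tail E e)"
      by (auto simp: awalk_append_iff awalk_Cons_iff)
    then have "connects_to_cycle E x"
      using q(1) e unfolding connects_to_cycle_def by (blast intro: reachable_awalkI)
    with \<open>x \<in> no_cycle_verts E\<close> show False
      by (simp add: no_cycle_verts_def)
  qed
  ultimately have "wf R"
    by (rule finite_acyclic_wf)
  then have "v \<in> no_cycle_verts E \<longrightarrow> v \<in> H" for v
  proof (induction v rule: wf_induct_rule)
    case (less v)
    show ?case
    proof
      assume v: "v \<in> no_cycle_verts E"
      have "head E e \<in> H" if "e \<in> out_arcs E v" for e
      proof -
        have "(head E e, v) \<in> R"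
          using that v by (auto simp: R_def intro: in_arcs_imp_in_arcs_ends)
        moreover have "head E e \<in> no_cycle_verts E"
          using hs_setsD(1)[OF no_cycle_verts_hs] hs_setsD(3)[OF no_cycle_verts_hs, of v] v that by blast
        ultimately show ?thesis
          using less by blast
      qed
      then show "v \<in> H"
        using hs_setsD(3)[OF assms, of v] v by (auto simp: no_cycle_verts_def)
    qed
  qed
  then show ?thesis
    by blast
qed

text \<open>For the second inclusion, the units are themselves SP(E_H) for the set H of vertices
  whose classes are units, and this H contains \<open>no_cycle_verts E\<close>.\<close>

lemma Units_SP: "Units (SP E) = carrier (SP (restriction E (no_cycle_verts E)))"
proof
  interpret comm_monoid "SP E"
    by (rule comm_monoid_SP)
  show "Units (SP E) \<subseteq> carrier (SP (restriction E (no_cycle_verts E)))"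
    by (rule Units_subset_order_ideal[OF order_ideal_SP_restriction[OF no_cycle_verts_hs]])
  note H = ideal_verts_hs[OF order_ideal_Units]
  show "carrier (SP (restriction E (no_cycle_verts E))) \<subseteq> Units (SP E)"
    using carrier_SP_restriction_mono[OF no_cycle_verts_hs H no_cycle_verts_subset_hs[OF H]]
      order_ideal_eq[OF order_ideal_Units] by simp
qed

subsection \<open>Sandpile groups\<close>

text \<open>Representatives are left unchanged, from which the identity and composition laws of the
  direct system follow at once.\<close>

lemma groth_map_restriction:
  assumes "H \<in> hs_sets E" "K \<in> hs_sets E" "H \<subseteq> K"
    and "a \<in> carrier (SP (restriction E H))" "b \<in> carrier (SP (restriction E H))"
  shows "groth_map (SP (restriction E K)) (SP_map (restriction E K)) (groth_class (SP (restriction E H)) a b)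
    = groth_class (SP (restriction E K)) a b"
  using groth_map_groth_class[OF comm_monoid_SP comm_monoid_SP SP_map_hom[OF assms(1-3)] assms(4,5)]
  by (simp add: SP_map_restriction[OF assms(1-3)] assms(4,5))

lemma direct_system_sandpile_groups:
  "direct_system (hs_sets E) (\<subseteq>) (\<lambda>H. grothendieck (SP (restriction E H)))
     (\<lambda>H K. groth_map (SP (restriction E K)) (SP_map (restriction E K)))"
proof (rule direct_system.intro)
  show "hs_sets E \<noteq> {}"
    using verts_hs by blast
  show "\<exists>k\<in>hs_sets E. i \<subseteq> k \<and> j \<subseteq> k" if "i \<in> hs_sets E" "j \<in> hs_sets E" for i j
    using that verts_hs hs_setsD(1) by blast
  show "group (grothendieck (SP (restriction E i)))" for i
    using comm_monoid.comm_group_grothendieck[OF comm_monoid_SP] by (rule comm_group.axioms(2))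
  show "groth_map (SP (restriction E j)) (SP_map (restriction E j))
      \<in> hom (grothendieck (SP (restriction E i))) (grothendieck (SP (restriction E j)))"
    if "i \<in> hs_sets E" "j \<in> hs_sets E" "i \<subseteq> j" for i j
    by (rule groth_map_hom[OF comm_monoid_SP comm_monoid_SP SP_map_hom[OF that]])
  show "groth_map (SP (restriction E i)) (SP_map (restriction E i)) x = x"
    if "i \<in> hs_sets E" "x \<in> carrier (grothendieck (SP (restriction E i)))" for i x
    using that by (auto simp: comm_monoid.carrier_grothendieck[OF comm_monoid_SP] groth_map_restriction)
  show "groth_map (SP (restriction E k)) (SP_map (restriction E k))
      (groth_map (SP (restriction E j)) (SP_map (restriction E j)) x)
    = groth_map (SP (restriction E k)) (SP_map (restriction E k)) x"
    if "i \<in> hs_sets E" "j \<in> hs_sets E" "k \<in> hs_sets E" "i \<subseteq> j" "j \<subseteq> k"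
      "x \<in> carrier (grothendieck (SP (restriction E i)))" for i j k x
    using that carrier_SP_restriction_mono[of i j]
    by (auto simp: comm_monoid.carrier_grothendieck[OF comm_monoid_SP] groth_map_restriction subset_iff)
qed auto

lemma dirlim_sandpile_groups:
  defines "G \<equiv> \<lambda>H. grothendieck (SP (restriction E H))"
    and "\<phi> \<equiv> \<lambda>H K. groth_map (SP (restriction E K)) (SP_map (restriction E K))"
  shows "\<exists>h \<in> iso (dirlim (hs_sets E) (\<subseteq>) G \<phi>) (grothendieck (SP E)).
     \<forall>H \<in> hs_sets E. \<forall>x \<in> carrier (G H).
       h (dirlim_in (hs_sets E) (\<subseteq>) G \<phi> H x) = groth_map (SP E) (SP_map E) x"
proof -
  have "direct_system (hs_sets E) (\<subseteq>) G \<phi>"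
    unfolding G_def \<phi>_def by (rule direct_system_sandpile_groups)
  from direct_system.dirlim_iso_top[OF this verts_hs] hs_setsD(1) show ?thesis
    by (simp add: G_def \<phi>_def restriction_verts)
qed

text \<open>The sum z_H is also an idempotent of SP(E), and its unit group there is the one computed
  inside SP(E_H), because SP(E_H) is an order-ideal.\<close>

lemma maximal_subgroup_recurrent:
  assumes "H \<in> hs_sets E"
  shows "maximal_subgroup (recurrent (SP (restriction E H))) (SP E)"
proof -
  interpret finite_comm_monoid "SP (restriction E H)"
    by (rule finite_comm_monoid_SP_restriction[OF assms])
  have idem: "idem_prod \<otimes>\<^bsub>SP E\<^esub> idem_prod = idem_prod"
    using mult_SP_restriction[OF assms idem_prod_closed idem_prod_closed] idem_prod_idem by simp
  have "recurrent (SP (restriction E H)) = Units (idem_monoid (SP E) idem_prod)"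
    unfolding recurrent_eq_Units
    by (rule Units_idem_monoid_order_ideal[symmetric, OF order_ideal_SP_restriction[OF assms]
          idem_prod_closed idem comm_monoid_SP mult_SP_restriction[OF assms]])
  moreover have "idem_prod \<in> idempotents (SP E)"
    using idem idem_prod_closed order_idealD(1)[OF order_ideal_SP_restriction[OF assms]]
    by (auto simp: idempotents_def)
  ultimately show ?thesis
    unfolding maximal_subgroup_def by blast
qed

end

theorem theorem2p10:
  fixes E :: "('v, 'e) pre_digraph"
  assumes "sandpile_graph E"
  shows
    "(\<forall>H \<in> hs_sets E. \<forall>H' \<in> hs_sets E. H \<subseteq> H' \<longrightarrow>
        (let F = restriction E H; F' = restriction E H' in
          (\<forall>a. set_mset a \<subseteq> H \<longrightarrow> SP_map F' (SP_class F a) = SP_class F' a) \<and>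
          SP_map F' \<in> hom (SP F) (SP F') \<and>
          inj_on (SP_map F') (carrier (SP F)) \<and>
          submonoid (SP_map F' ` carrier (SP F)) (SP F')))
   \<and>
     (no_cycle_verts E \<in> hs_sets E \<and>
      SP_map E ` carrier (SP (restriction E (no_cycle_verts E))) = Units (SP E))
   \<and>
     (\<forall>H \<in> hs_sets E.
        order_ideal (SP_map E ` carrier (SP (restriction E H))) (SP E) \<and>
        Units (SP E) \<subseteq> SP_map E ` carrier (SP (restriction E H)) \<and>
        SP_map E ` carrier (SP (restriction E H))
          = order_ideal_gen (SP E) ((\<lambda>v. SP_class E {#v#}) ` H))
   \<and>
     (\<forall>I. order_ideal I (SP E) \<longrightarrow>
        (let H = {v \<in> verts E. SP_class E {#v#} \<in> I} in
          H \<in> hs_sets E \<and> I = SP_map E ` carrier (SP (restriction E H))))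
   \<and>
     (let L = inclusion_order (hs_sets E);
          K = inclusion_order {I. order_ideal I (SP E)} in
        lattice L \<and>
        (\<forall>H \<in> hs_sets E. \<forall>H' \<in> hs_sets E.
           H \<squnion>\<^bsub>L\<^esub> H' = hs_closure E (H \<union> H') \<and> H \<sqinter>\<^bsub>L\<^esub> H' = H \<inter> H') \<and>
        lattice K \<and>
        (\<exists>f. lattice_iso f L K))
   \<and>
     (let GE = grothendieck (SP E);
          G = (\<lambda>H. grothendieck (SP (restriction E H)));
          \<phi> = (\<lambda>H H'. groth_map (SP (restriction E H')) (SP_map (restriction E H'))) in
        direct_system (hs_sets E) (\<subseteq>) G \<phi> \<and>
        (\<exists>h \<in> iso (dirlim (hs_sets E) (\<subseteq>) G \<phi>) GE.
           \<forall>H \<in> hs_sets E. \<forall>x \<in> carrier (G H).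
             h (dirlim_in (hs_sets E) (\<subseteq>) G \<phi> H x) = groth_map (SP E) (SP_map E) x))
   \<and>
     (\<forall>H \<in> hs_sets E.
        (let M = SP (restriction E H);
             z = (\<Otimes>\<^bsub>M\<^esub>x \<in> idempotents M. x) in
          finite (idempotents M) \<and>
          recurrent M = z <#\<^bsub>M\<^esub> carrier M \<and>
          (\<lambda>x. groth_class M x \<one>\<^bsub>M\<^esub>) \<in> iso (idem_monoid M z) (grothendieck M) \<and>
          maximal_subgroup (SP_map E ` recurrent M) (SP E)))"
proof -
  interpret sandpile_graph E
    by fact
  have iso: "lattice (inclusion_order {I. order_ideal I (SP E)})"
    "lattice_iso (\<lambda>H. carrier (SP (restriction E H))) (inclusion_order (hs_sets E))
       (inclusion_order {I. order_ideal I (SP E)})"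
    by (rule lattice_iso_inclusionI[OF lattice_hs_sets bij_betw_order_ideals SP_restriction_subset_iff],
        assumption+)+
  \<comment> \<open>The natural map fixes every class over H, so images under
    \<open>SP_map E\<close> turn into plain subsets of SP(E).\<close>
  have image: "SP_map E ` carrier (SP (restriction E H)) = carrier (SP (restriction E H))"
    if "H \<in> hs_sets E" for H
    using SP_map_image[OF that] by blast
  interpret SP: comm_monoid "SP E"
    by (rule comm_monoid_SP)
  show ?thesis
    unfolding Let_def
  proof (intro conjI ballI impI allI)
    fix H K
    assume HK: "H \<in> hs_sets E" "K \<in> hs_sets E"
    show "H \<squnion>\<^bsub>inclusion_order (hs_sets E)\<^esub> K = hs_closure E (H \<union> K)"
      "H \<sqinter>\<^bsub>inclusion_order (hs_sets E)\<^esub> K = H \<inter> K"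
      by (rule join_hs_sets[OF HK] meet_hs_sets[OF HK])+
    assume sub: "H \<subseteq> K"
    show "SP_map (restriction E K) (SP_class (restriction E H) a) = SP_class (restriction E K) a"
      if "set_mset a \<subseteq> H" for a
      using SP_map_restriction[OF HK sub] HK sub that
      by (auto simp: carrier_SP_restriction SP_class_restriction)
    show "SP_map (restriction E K) \<in> hom (SP (restriction E H)) (SP (restriction E K))"
      by (rule SP_map_hom[OF HK sub])
    show "inj_on (SP_map (restriction E K)) (carrier (SP (restriction E H)))"
      by (rule inj_onI) (simp add: SP_map_restriction[OF HK sub])
    show "submonoid (SP_map (restriction E K) ` carrier (SP (restriction E H))) (SP (restriction E K))"
      by (rule submonoid_SP_map[OF HK sub])
  next
    fix H
    assume H: "H \<in> hs_sets E"
    show "order_ideal (SP_map E ` carrier (SP (restriction E H))) (SP E)"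
      unfolding image[OF H] by (rule order_ideal_SP_restriction[OF H])
    then show "Units (SP E) \<subseteq> SP_map E ` carrier (SP (restriction E H))"
      by (rule SP.Units_subset_order_ideal)
    show "SP_map E ` carrier (SP (restriction E H))
        = order_ideal_gen (SP E) ((\<lambda>v. SP_class E {#v#}) ` H)"
      unfolding image[OF H] by (rule SP_restriction_eq_order_ideal_gen[OF H])
    interpret M: finite_comm_monoid "SP (restriction E H)"
      by (rule finite_comm_monoid_SP_restriction[OF H])
    let ?z = "\<Otimes>\<^bsub>SP (restriction E H)\<^esub>x \<in> idempotents (SP (restriction E H)). x"
    show "finite (idempotents (SP (restriction E H)))"
      by (rule M.finite_idempotents)
    show "recurrent (SP (restriction E H)) = ?z <#\<^bsub>SP (restriction E H)\<^esub> carrier (SP (restriction E H))"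
      by (rule M.recurrent_eq[unfolded M.idem_prod_def])
    show "(\<lambda>x. groth_class (SP (restriction E H)) x \<one>\<^bsub>SP (restriction E H)\<^esub>)
        \<in> iso (idem_monoid (SP (restriction E H)) ?z) (grothendieck (SP (restriction E H)))"
      by (rule M.groth_class_iso[unfolded M.idem_prod_def])
    have "SP_map E ` recurrent (SP (restriction E H)) = recurrent (SP (restriction E H))"
      by (rule SP_map_image[OF H]) (auto simp: recurrent_def)
    then show "maximal_subgroup (SP_map E ` recurrent (SP (restriction E H))) (SP E)"
      using maximal_subgroup_recurrent[OF H] by simp
  next
    show "SP_map E ` carrier (SP (restriction E (no_cycle_verts E))) = Units (SP E)"
      unfolding image[OF no_cycle_verts_hs] Units_SP ..
  next
    fix I
    assume I: "order_ideal I (SP E)"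
    show hs: "{v \<in> verts E. SP_class E {#v#} \<in> I} \<in> hs_sets E"
      using ideal_verts_hs[OF I] by (simp add: ideal_verts_def)
    show "I = SP_map E ` carrier (SP (restriction E {v \<in> verts E. SP_class E {#v#} \<in> I}))"
      unfolding image[OF hs] by (rule order_ideal_eq[OF I, unfolded ideal_verts_def])
  next
    show "\<exists>f. lattice_iso f (inclusion_order (hs_sets E)) (inclusion_order {I. order_ideal I (SP E)})"
      using iso(2) by blast
  qed (fact no_cycle_verts_hs lattice_hs_sets iso(1) direct_system_sandpile_groups dirlim_sandpile_groups)+
qed

end
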